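(* Let $H$ be an infinite-dimensional separable Hilbert space, let $A\in\mathcal B(H)$ be a positive operator, let $I$ be a finite index set, and let $\{f_i\}_{i\in I}\subset H$. Then, for every $p>0$, the system $\{A^nf_i\}_{n\in\mathbb N,\,i\in I}$ is a frame for $H$ if and only if $\{A^{pn}f_i\}_{n\in\mathbb N,\,i\in I}$ is a frame for $H$.
   Context: $\mathbb N=\{0,1,2,\dots\}$; $p$ is an arbitrary positive real number. $H$ is a complex Hilbert space and $\mathcal B(H)$ is the algebra of bounded linear operators on $H$. Positive means $A$ is self-adjoint with $\langle Ax,x\rangle\ge0$ for all $x\in H$ (not necessarily injective). $A^p$ is defined by the continuous functional calculus, and $A^{pn}:=(A^p)^n$, with $A^0=I_H$. A family $\{f_\gamma\}_{\gamma\in G}$ (indexed by a countable set $G$, repetitions allowed) is a frame for $H$ if there are constants $0<a\le b<\infty$ with $a\|x\|^2\le\sum_{\gamma\in G}|\langle x,f_\gamma\rangle|^2\le b\|x\|^2$ for all $x\in H$. *)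

theory Defs
  imports "HOL-Analysis.Analysis" "HOL-Computational_Algebra.Polynomial"
begin

class complex_inner = real_normed_vector +
  fixes scaleC :: "complex \<Rightarrow> 'a \<Rightarrow> 'a" (infixr "*\<^sub>C" 75)
    and cinner :: "'a \<Rightarrow> 'a \<Rightarrow> complex"
  assumes scaleC_add_right: "c *\<^sub>C (x + y) = c *\<^sub>C x + c *\<^sub>C y"
    and scaleC_add_left: "(c + d) *\<^sub>C x = c *\<^sub>C x + d *\<^sub>C x"
    and scaleC_scaleC: "c *\<^sub>C (d *\<^sub>C x) = (c * d) *\<^sub>C x"
    and scaleC_one: "1 *\<^sub>C x = x"
    and scaleR_scaleC: "r *\<^sub>R x = complex_of_real r *\<^sub>C x"
    and cinner_commute: "cinner x y = cnj (cinner y x)"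
    and cinner_add_left: "cinner (x + y) z = cinner x z + cinner y z"
    and cinner_scaleC_left: "cinner (c *\<^sub>C x) y = c * cinner x y"
    \<comment> \<open>Positive definiteness of the inner product follows from this axiom and the norm axioms.\<close>
    and cinner_norm: "cinner x x = complex_of_real ((norm x)\<^sup>2)"

class chilbert_space = complex_inner + complete_space

lemma vector_space_scaleC: "vector_space (scaleC :: complex \<Rightarrow> 'a \<Rightarrow> 'a::complex_inner)"
  by unfold_locales
    (simp_all add: scaleC_add_right scaleC_add_left scaleC_scaleC scaleC_one)

global_interpretation complex_vector:
  vector_space "scaleC :: complex \<Rightarrow> 'a \<Rightarrow> 'a::complex_inner"
  by (rule vector_space_scaleC)

definition infinite_dimensional :: "'a::complex_inner itself \<Rightarrow> bool" where
  "infinite_dimensional _ \<longleftrightarrow>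
     \<not> (\<exists>S::'a set. finite S \<and> complex_vector.span S = UNIV)"

definition separable :: "'a::topological_space itself \<Rightarrow> bool" where
  "separable _ \<longleftrightarrow> (\<exists>D::'a set. countable D \<and> closure D = UNIV)"

definition bounded_clinear :: "('a::complex_inner \<Rightarrow> 'a) \<Rightarrow> bool" where
  "bounded_clinear A \<longleftrightarrow> bounded_linear A \<and> (\<forall>c x. A (c *\<^sub>C x) = c *\<^sub>C A x)"

definition selfadjoint_op :: "('a::complex_inner \<Rightarrow> 'a) \<Rightarrow> bool" where
  "selfadjoint_op A \<longleftrightarrow>
     bounded_clinear A \<and> (\<forall>x y. cinner (A x) y = cinner x (A y))"

definition positive_op :: "('a::complex_inner \<Rightarrow> 'a) \<Rightarrow> bool" where
  "positive_op A \<longleftrightarrow>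
     selfadjoint_op A \<and> (\<forall>x. cinner (A x) x \<in> \<real>\<^sub>\<ge>\<^sub>0)"

definition op_spectrum :: "('a::complex_inner \<Rightarrow> 'a) \<Rightarrow> complex set" where
  "op_spectrum A = {z. \<not> (\<exists>B. bounded_clinear B \<and>
     (\<forall>x. B (A x - z *\<^sub>C x) = x) \<and> (\<forall>x. A (B x) - z *\<^sub>C B x = x))}"

definition op_poly :: "complex poly \<Rightarrow> ('a::complex_inner \<Rightarrow> 'a) \<Rightarrow> 'a \<Rightarrow> 'a" where
  "op_poly q A x = (\<Sum>k\<le>degree q. coeff q k *\<^sub>C (A ^^ k) x)"

text \<open>The continuous functional calculus of a self-adjoint operator \<open>A\<close>: the polynomial calculus
  \<open>q \<mapsto> q(A)\<close> extended by continuity, from the supremum norm on the spectrum of \<open>A\<close> to the operator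
  norm. It is meaningful for functions \<open>g\<close> that are continuous on the spectrum; such a \<open>g\<close> is a
  uniform limit of polynomials there because the spectrum is a compact subset of the real line.\<close>

definition cfc :: "('a::complex_inner \<Rightarrow> 'a) \<Rightarrow> (complex \<Rightarrow> complex) \<Rightarrow> 'a \<Rightarrow> 'a" where
  "cfc A g = (THE B. bounded_clinear B \<and>
     (\<exists>q. uniform_limit (op_spectrum A) (\<lambda>n. poly (q n)) g sequentially \<and>
          (\<lambda>n. onorm (\<lambda>x. op_poly (q n) A x - B x)) \<longlonglongrightarrow> 0))"

text \<open>For positive \<open>A\<close> the spectrum consists of nonnegative reals, so \<open>Re\<close> loses nothing. For
  \<open>p > 0\<close> the function \<open>t \<mapsto> t powr p\<close> is continuous on \<open>[0, \<infinity>)\<close>, with value \<open>0\<close> at \<open>0\<close>.\<close>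

definition op_powr :: "('a::complex_inner \<Rightarrow> 'a) \<Rightarrow> real \<Rightarrow> 'a \<Rightarrow> 'a" where
  "op_powr A p = cfc A (\<lambda>z. complex_of_real (Re z powr p))"

text \<open>Summability is required explicitly because \<open>infsum\<close> is \<open>0\<close> on divergent families.\<close>

definition is_frame :: "'i set \<Rightarrow> ('i \<Rightarrow> 'a::complex_inner) \<Rightarrow> bool" where
  "is_frame G f \<longleftrightarrow> countable G \<and>
     (\<exists>a b::real. 0 < a \<and> a \<le> b \<and>
       (\<forall>x. (\<lambda>\<gamma>. (cmod (cinner x (f \<gamma>)))\<^sup>2) summable_on G \<and>
            a * (norm x)\<^sup>2 \<le> (\<Sum>\<^sub>\<infinity>\<gamma>\<in>G. (cmod (cinner x (f \<gamma>)))\<^sup>2) \<and>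
            (\<Sum>\<^sub>\<infinity>\<gamma>\<in>G. (cmod (cinner x (f \<gamma>)))\<^sup>2) \<le> b * (norm x)\<^sup>2))"

end

theory Submission
  imports Defs "HOL-Computational_Algebra.Fundamental_Theorem_Algebra"
begin

text \<open>
  Write \<open>A\<^sup>s\<close> for the powers of \<open>A\<close>, and \<open>S\<^sub>s(x)\<close> for the frame sum of the orbits under \<open>A\<^sup>s\<close>. It is
  enough to pass from \<open>A\<close> to \<open>A\<^sup>p\<close>, because \<open>A\<^sup>p\<close> is positive and \<open>(A\<^sup>p)\<^bsup>1/p\<^esup> = A\<close>
  (\<open>op_powr_inverse\<close>).

  So let the orbits under \<open>A\<close> form a frame with bounds \<open>a\<close>, \<open>b\<close>. From
  \<open>a \<parallel>A\<^sup>n x\<parallel>\<^sup>2 \<le> S\<^sub>1(A\<^sup>n x) \<le> S\<^sub>1(x) \<le> b \<parallel>x\<parallel>\<^sup>2\<close> the powers of \<open>A\<close> are bounded, hence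
  \<open>\<parallel>A\<parallel> \<le> 1\<close> (\<open>orbit_frame_contraction\<close>). This makes the binomial series
  \<open>A\<^sup>s = \<Sum>\<^sub>j (s choose j) (A - 1)\<^sup>j\<close> available, and for \<open>s\<close> in a bounded interval \<open>[1, W]\<close> its
  coefficients have a common summable majorant. Every sampling time \<open>v n\<close> is \<open>u k + s\<close> with
  \<open>s \<in> [1, 1 + u]\<close>, apart from finitely many \<open>n\<close>. Inserting the series into
  \<open>\<langle>A\<^bsup>vn\<^esup> x, f\<^sub>i\<rangle> = \<langle>A\<^bsup>uk\<^esup> A\<^sup>s x, f\<^sub>i\<rangle>\<close> gives \<open>orbit_energy_comparison\<close>: up to finitely many
  terms and constants, \<open>S\<^sub>v(x) \<le> S\<^sub>u(x) + \<parallel>A x - x\<parallel>\<^sup>2\<close>, provided that \<open>S\<^sub>u\<close> satisfies a Bessel bound.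

  With \<open>u = 1\<close>, \<open>v = p\<close> this is the upper frame bound for \<open>A\<^sup>p\<close>. With \<open>u = p\<close>, \<open>v = 1\<close> it says
  \<open>a \<parallel>A x\<parallel>\<^sup>2 \<le> const (S\<^sub>p(x) + \<parallel>A x - x\<parallel>\<^sup>2)\<close>, which is a lower bound wherever \<open>A x - x\<close> is small
  compared to \<open>x\<close>. Since \<open>I\<close> is finite, this is so on a subspace of finite codimension
  (\<open>frame_generator_near_identity\<close>): if the first \<open>n\<close> samples of \<open>y = A x - x\<close> vanish, then
  \<open>a \<parallel>y\<parallel>\<^sup>2 \<le> S\<^sub>1(y) = S\<^sub>1(A\<^sup>n y) \<le> b \<parallel>A\<^sup>n y\<parallel>\<^sup>2\<close>, and \<open>\<parallel>A\<^sup>n (A - 1)\<parallel> \<le> 1 / (n + 1)\<close> because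
  \<open>t\<^sup>n (1 - t) \<le> 1 / (n + 1)\<close> on \<open>[0, 1]\<close>. A lower bound on a subspace of finite codimension extends
  to the whole space as soon as \<open>S\<^sub>p(x) = 0\<close> only for \<open>x = 0\<close>
  (\<open>lower_bound_finite_codimension\<close>). This last condition holds because \<open>A\<close> is a limit of polynomials
  in \<open>A\<^sup>p\<close>: if all \<open>\<langle>A\<^bsup>pn\<^esup> x, f\<^sub>i\<rangle>\<close> vanish, so do all \<open>\<langle>A\<^sup>n x, f\<^sub>i\<rangle>\<close>.

  The facts about functions of \<open>A\<close> rest on the estimate \<open>\<parallel>q(A)\<parallel> \<le> sup |q|\<close> over the spectrum of \<open>A\<close>
  for polynomials \<open>q\<close> (\<open>op_poly_norm_le_spectrum\<close>), which is what makes the continuous functional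
  calculus well defined.
\<close>


section \<open>Complex inner product spaces\<close>

instance chilbert_space \<subseteq> banach ..

lemma cinner_add_right: "cinner x (y + z) = cinner x y + cinner x (z::'a::complex_inner)"
  by (metis cinner_add_left cinner_commute complex_cnj_add)

lemma cinner_scaleC_right: "cinner x (c *\<^sub>C y) = cnj c * cinner x (y::'a::complex_inner)"
  by (metis cinner_commute cinner_scaleC_left complex_cnj_mult)

lemma scaleC_minus_one: "- x = (-1) *\<^sub>C (x::'a::complex_inner)"
  by simp

lemma cinner_minus_left: "cinner (- x) y = - cinner x (y::'a::complex_inner)"
  unfolding scaleC_minus_one[of x] cinner_scaleC_left by simp

lemma cinner_minus_right: "cinner x (- y) = - cinner x (y::'a::complex_inner)"
  unfolding scaleC_minus_one[of y] cinner_scaleC_right by simp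

lemma cinner_diff_left: "cinner (x - y) z = cinner x z - cinner y (z::'a::complex_inner)"
  using cinner_add_left[of x "- y" z] by (simp add: cinner_minus_left)

lemma cinner_diff_right: "cinner x (y - z) = cinner x y - cinner x (z::'a::complex_inner)"
  using cinner_add_right[of x y "- z"] by (simp add: cinner_minus_right)

lemma cinner_zero_left [simp]: "cinner 0 (x::'a::complex_inner) = 0"
  using cinner_diff_left[of 0 0 x] by simp

lemma cinner_zero_right [simp]: "cinner (x::'a::complex_inner) 0 = 0"
  using cinner_diff_right[of x 0 0] by simp

lemma cinner_sum_left: "cinner (\<Sum>i\<in>S. g i) y = (\<Sum>i\<in>S. cinner (g i) (y::'a::complex_inner))"
  by (induction S rule: infinite_finite_induct) (auto simp: cinner_add_left)

lemma cinner_sum_right: "cinner y (\<Sum>i\<in>S. g i) = (\<Sum>i\<in>S. cinner (y::'a::complex_inner) (g i))"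
  by (induction S rule: infinite_finite_induct) (auto simp: cinner_add_right)

lemma norm_square_cinner: "(norm (x::'a::complex_inner))\<^sup>2 = Re (cinner x x)"
  by (simp add: cinner_norm)

lemma norm_diff_square:
  "(norm (x - y))\<^sup>2 = (norm x)\<^sup>2 - 2 * Re (cinner x y) + (norm (y::'a::complex_inner))\<^sup>2"
proof -
  have "Re (cinner y x) = Re (cinner x y)"
    by (subst cinner_commute) simp
  then show ?thesis
    by (simp add: norm_square_cinner cinner_diff_left cinner_diff_right)
qed

lemma norm_scaleC: "norm (c *\<^sub>C x) = cmod c * norm (x::'a::complex_inner)"
proof -
  have "cinner (c *\<^sub>C x) (c *\<^sub>C x) = (c * cnj c) * cinner x x"
    by (simp only: cinner_scaleC_left cinner_scaleC_right mult.assoc mult.left_commute)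
  also have "\<dots> = complex_of_real ((cmod c * norm x)\<^sup>2)"
    by (simp only: cinner_norm complex_norm_square[symmetric] power_mult_distrib of_real_mult)
  finally have "cinner (c *\<^sub>C x) (c *\<^sub>C x) = complex_of_real ((cmod c * norm x)\<^sup>2)" .
  then have "(norm (c *\<^sub>C x))\<^sup>2 = (cmod c * norm x)\<^sup>2"
    by (metis cinner_norm of_real_eq_iff)
  then show ?thesis by simp
qed

lemma cauchy_schwarz: "cmod (cinner x y) \<le> norm x * norm (y::'a::complex_inner)"
proof (cases "cinner x y = 0")
  case False
  define a where "a = cinner x y"
  define n where "n = (norm y)\<^sup>2"
  have y: "n \<noteq> 0" using False by (auto simp: n_def)
  have "0 \<le> (norm (of_real n *\<^sub>C x - a *\<^sub>C y))\<^sup>2" by simp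
  also have "\<dots> = n\<^sup>2 * (norm x)\<^sup>2 - 2 * Re (of_real n * cnj a * a) + (cmod a)\<^sup>2 * n"
    by (simp add: norm_diff_square norm_scaleC power_mult_distrib cinner_scaleC_left
        cinner_scaleC_right norm_power a_def n_def)
  also have "Re (of_real n * cnj a * a) = n * (cmod a)\<^sup>2"
  proof -
    have "of_real n * cnj a * a = of_real (n * (cmod a)\<^sup>2)"
      by (simp add: complex_norm_square mult.assoc mult.commute del: of_real_power)
    then show ?thesis by (metis Re_complex_of_real)
  qed
  finally have "n * (cmod a)\<^sup>2 \<le> n * (n * (norm x)\<^sup>2)" 
    by (simp add: power2_eq_square algebra_simps)
  then have "(cmod a)\<^sup>2 \<le> n * (norm x)\<^sup>2"
    by (rule mult_left_le_imp_le) (use y in \<open>simp add: n_def\<close>)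
  then have "(cmod a)\<^sup>2 \<le> (norm x * norm y)\<^sup>2"
    by (simp add: n_def power_mult_distrib mult.commute)
  then show ?thesis unfolding a_def by (rule power2_le_imp_le) simp
qed simp

lemma bounded_linear_cinner_left: "bounded_linear (\<lambda>x. cinner x (y::'a::complex_inner))"
  by (rule bounded_linear_intro[where K = "norm y"])
    (auto simp: cinner_add_left cinner_scaleC_left scaleR_scaleC cauchy_schwarz
      simp flip: scaleR_conv_of_real)

lemma bounded_clinear_scaleC: "bounded_clinear (\<lambda>x::'a::complex_inner. c *\<^sub>C x)"
  unfolding bounded_clinear_def
  by (intro conjI allI bounded_linear_intro[where K = "cmod c"])
    (auto simp: scaleC_add_right scaleR_scaleC scaleC_scaleC norm_scaleC mult.commute)

context
  fixes A :: "'a::complex_inner \<Rightarrow> 'a"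
  assumes A: "bounded_clinear A"
begin

lemma bounded_linear_clinear: "bounded_linear A"
  using A by (simp add: bounded_clinear_def)

lemma clinear_add: "A (x + y) = A x + A y"
  by (rule linear_add[OF bounded_linear.linear[OF bounded_linear_clinear]])

lemma clinear_diff: "A (x - y) = A x - A y"
  by (rule linear_diff[OF bounded_linear.linear[OF bounded_linear_clinear]])

lemma clinear_zero: "A 0 = 0"
  by (rule linear_0[OF bounded_linear.linear[OF bounded_linear_clinear]])

lemma clinear_sum: "A (\<Sum>i\<in>S. g i) = (\<Sum>i\<in>S. A (g i))"
  by (rule linear_sum[OF bounded_linear.linear[OF bounded_linear_clinear]])

lemma clinear_scaleC: "A (c *\<^sub>C x) = c *\<^sub>C A x"
  using A by (simp add: bounded_clinear_def)

lemma bounded_clinear_funpow: "bounded_clinear (A ^^ n)"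
proof (induction n)
  case 0
  have "bounded_clinear (id :: 'a \<Rightarrow> 'a)"
    using bounded_clinear_scaleC[where 'a = 'a, of 1] by (simp add: scaleC_one id_def)
  then show ?case by (simp add: id_def)
next
  case (Suc n)
  then show ?case using A
    by (auto simp: bounded_clinear_def o_def intro: bounded_linear_compose)
qed

end

lemma bounded_clinear_compose:
  "bounded_clinear S \<Longrightarrow> bounded_clinear T \<Longrightarrow> bounded_clinear (\<lambda>x. S (T x))"
  by (auto simp: bounded_clinear_def intro: bounded_linear_compose)

lemma bounded_clinear_add:
  "bounded_clinear S \<Longrightarrow> bounded_clinear T \<Longrightarrow> bounded_clinear (\<lambda>x. S x + T x)"
  by (auto simp: bounded_clinear_def scaleC_add_right intro: bounded_linear_add)

lemma bounded_clinear_diff: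
  "bounded_clinear S \<Longrightarrow> bounded_clinear T \<Longrightarrow> bounded_clinear (\<lambda>x. S x - T x)"
  by (auto simp: bounded_clinear_def complex_vector.scale_right_diff_distrib
      intro: bounded_linear_sub)

lemma bounded_clinear_intro:
  fixes T :: "'a::complex_inner \<Rightarrow> 'a"
  assumes "\<And>x y. T (x + y) = T x + T y" "\<And>c x. T (c *\<^sub>C x) = c *\<^sub>C T x"
    and "\<And>x. norm (T x) \<le> K * norm x"
  shows "bounded_clinear T"
  unfolding bounded_clinear_def
  using assms by (auto simp: scaleR_scaleC mult.commute intro!: bounded_linear_intro[where K = K])

section \<open>Polynomials of an operator\<close>

lemma op_poly_upto:
  assumes "degree q \<le> n"
  shows "op_poly q A x = (\<Sum>k\<le>n. coeff q k *\<^sub>C (A ^^ k) x)"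
  unfolding op_poly_def
  by (rule sum.mono_neutral_left) (use assms in \<open>auto simp: coeff_eq_0\<close>)

lemma op_poly_0 [simp]: "op_poly 0 A x = 0"
  by (simp add: op_poly_def)

lemma op_poly_pCons: "op_poly (pCons c q) A x = c *\<^sub>C x + op_poly q A (A x)"
proof -
  have "op_poly (pCons c q) A x = (\<Sum>k\<le>Suc (degree q). coeff (pCons c q) k *\<^sub>C (A ^^ k) x)"
    by (rule op_poly_upto) (rule degree_pCons_le)
  also have "\<dots> = c *\<^sub>C x + (\<Sum>k\<le>degree q. coeff q k *\<^sub>C (A ^^ Suc k) x)"
    by (subst sum.atMost_Suc_shift) simp
  finally show ?thesis by (simp add: op_poly_def funpow_swap1)
qed

lemma op_poly_add: "op_poly (p + q) A x = op_poly p A x + op_poly q A x"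
proof -
  let ?n = "max (degree p) (degree q)"
  have "op_poly (p + q) A x = (\<Sum>k\<le>?n. coeff (p + q) k *\<^sub>C (A ^^ k) x)"
    by (rule op_poly_upto) (rule degree_add_le_max)
  then show ?thesis
    by (simp add: op_poly_upto[of p ?n] op_poly_upto[of q ?n] scaleC_add_left sum.distrib)
qed

lemma op_poly_smult: "op_poly (smult c q) A x = c *\<^sub>C op_poly q A x"
  using op_poly_upto[of "smult c q" "degree q" A x]
  by (simp add: op_poly_def complex_vector.scale_sum_right scaleC_scaleC)

lemma op_poly_diff: "op_poly (p - q) A x = op_poly p A x - op_poly q A x"
proof -
  have "op_poly (- q) A x = - op_poly q A x"
    using op_poly_smult[of "- 1" q A x]
    by (simp only: smult_minus_left smult_1_left complex_vector.scale_minus_left scaleC_one)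
  then show ?thesis using op_poly_add[of p "- q" A x] by simp
qed

context
  fixes A :: "'a::complex_inner \<Rightarrow> 'a"
  assumes A: "bounded_clinear A"
begin

lemma bounded_clinear_op_poly: "bounded_clinear (op_poly q A)"
proof -
  have "bounded_clinear (\<lambda>x. \<Sum>k\<in>S. coeff q k *\<^sub>C (A ^^ k) x)" for S
  proof (induction S rule: infinite_finite_induct)
    case (insert k S)
    then show ?case
      by (simp add: bounded_clinear_add
          bounded_clinear_compose[OF bounded_clinear_scaleC bounded_clinear_funpow[OF A]])
  qed (auto simp: bounded_clinear_def)
  then show ?thesis by (simp add: op_poly_def[abs_def])
qed

lemma op_poly_commute: "op_poly q A (A x) = A (op_poly q A x)"
  by (simp add: op_poly_def clinear_sum[OF A] clinear_scaleC[OF A] funpow_swap1)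

lemma op_poly_mult: "op_poly (p * q) A x = op_poly p A (op_poly q A x)"
proof (induction p arbitrary: x)
  case (pCons c p)
  then show ?case
    by (simp add: op_poly_add op_poly_smult op_poly_pCons op_poly_commute)
qed simp

lemma op_poly_monom: "op_poly (monom 1 n) A x = (A ^^ n) x"
  by (induction n arbitrary: x) (simp_all add: monom_0 monom_Suc op_poly_pCons scaleC_one funpow_swap1)

end

lemma selfadjoint_op_funpow:
  assumes "selfadjoint_op A"
  shows "cinner ((A ^^ n) x) y = cinner x ((A ^^ n) y)"
proof (induction n arbitrary: x)
  case (Suc n)
  then show ?case using assms by (simp add: selfadjoint_op_def funpow_swap1)
qed simp

text \<open>The adjoint of \<open>q(A)\<close> is \<open>q\<^sup>*(A)\<close>, where \<open>q\<^sup>*\<close> has the conjugate coefficients; on the real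
  line \<open>q\<^sup>*\<close> takes the conjugate values.\<close>

lemma op_poly_adjoint:
  assumes "selfadjoint_op A"
  shows "cinner (op_poly q A x) y = cinner x (op_poly (map_poly cnj q) A y)"
proof -
  have "degree (map_poly cnj q) = degree q" by (rule degree_map_poly) simp
  then show ?thesis
    by (simp add: op_poly_def cinner_sum_left cinner_sum_right cinner_scaleC_left
        cinner_scaleC_right selfadjoint_op_funpow[OF assms] coeff_map_poly)
qed

lemma poly_map_cnj: "poly (map_poly cnj q) (complex_of_real t) = cnj (poly q (of_real t))"
  by (induction q) (simp_all add: map_poly_pCons)

section \<open>The spectrum of a positive operator\<close>

text \<open>This is the Lax--Milgram argument: for small \<open>\<rho> > 0\<close> coercivity makes
  \<open>x \<mapsto> x - \<rho> d (T x - y)\<close> a contraction, and its fixed point solves \<open>T x = y\<close>.\<close>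

lemma coercive_op_invertible:
  fixes T :: "'a::chilbert_space \<Rightarrow> 'a"
  assumes T: "bounded_clinear T" and c: "c > 0"
    and coercive: "\<And>x. c * (norm x)\<^sup>2 \<le> Re (d * cinner (T x) x)"
  shows "\<exists>B. bounded_clinear B \<and> (\<forall>x. B (T x) = x) \<and> (\<forall>x. T (B x) = x)"
proof -
  obtain L where L: "L > 0" "\<And>x. norm (T x) \<le> norm x * L"
    using bounded_linear.pos_bounded[OF bounded_linear_clinear[OF T]] by blast
  define M where "M = cmod d * L + c"
  have M: "M > 0" "M \<ge> c" "cmod d * L \<le> M"
    using L c by (auto simp: M_def intro: add_nonneg_pos)
  define \<rho> where "\<rho> = c / M\<^sup>2"
  have \<rho>: "\<rho> > 0" using c M by (simp add: \<rho>_def)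
  define \<kappa> where "\<kappa> = sqrt (1 - c\<^sup>2 / M\<^sup>2)"
  have cM: "c\<^sup>2 / M\<^sup>2 \<le> 1" "c\<^sup>2 / M\<^sup>2 > 0"
    using c M by (auto simp: power_mono divide_le_eq_1)
  have \<kappa>: "0 \<le> \<kappa>" "\<kappa> < 1" "\<kappa>\<^sup>2 = 1 - c\<^sup>2 / M\<^sup>2"
    using cM by (auto simp: \<kappa>_def)
  have contraction: "norm (x - (of_real \<rho> * d) *\<^sub>C T x) \<le> \<kappa> * norm x" for x
  proof -
    have "cmod d * norm (T x) \<le> M * norm x"
    proof -
      have "cmod d * norm (T x) \<le> cmod d * (norm x * L)"
        by (rule mult_left_mono[OF L(2)]) simp
      also have "\<dots> = (cmod d * L) * norm x" by simp
      also have "\<dots> \<le> M * norm x" by (rule mult_right_mono[OF M(3)]) simp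
      finally show ?thesis .
    qed
    then have *: "(cmod d * norm (T x))\<^sup>2 \<le> M\<^sup>2 * (norm x)\<^sup>2"
      by (metis norm_ge_zero mult_nonneg_nonneg power_mono power_mult_distrib)
    have re: "Re (cinner x ((of_real \<rho> * d) *\<^sub>C T x)) = \<rho> * Re (d * cinner (T x) x)"
    proof -
      have "Re (cinner x y) = Re (cinner y x)" for y by (subst cinner_commute) simp
      then show ?thesis by (simp add: cinner_scaleC_left mult.assoc)
    qed
    have "(norm (x - (of_real \<rho> * d) *\<^sub>C T x))\<^sup>2
        = (norm x)\<^sup>2 - 2 * (\<rho> * Re (d * cinner (T x) x)) + \<rho>\<^sup>2 * (cmod d * norm (T x))\<^sup>2"
      using \<rho> by (simp add: norm_diff_square re norm_scaleC norm_mult power_mult_distrib mult.assoc)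
    also have "\<dots> \<le> (norm x)\<^sup>2 - 2 * (\<rho> * (c * (norm x)\<^sup>2)) + \<rho>\<^sup>2 * (M\<^sup>2 * (norm x)\<^sup>2)"
      using mult_left_mono[OF coercive[of x] less_imp_le[OF \<rho>]]
        mult_left_mono[OF * zero_le_power2[of \<rho>]] by linarith
    also have "\<dots> = (\<kappa> * norm x)\<^sup>2"
      unfolding power_mult_distrib \<kappa>(3) \<rho>_def using M(1) by (simp add: field_simps power2_eq_square)
    finally show ?thesis by (rule power2_le_imp_le) (use \<kappa> in simp)
  qed
  have d: "d \<noteq> 0" if "(x::'a) \<noteq> 0" for x
  proof
    assume "d = 0"
    then show False using coercive[of x] c that by (simp add: mult_le_0_iff)
  qed
  have "\<exists>!x. T x = y" for y
  proof -
    define F where "F = (\<lambda>x. x - (of_real \<rho> * d) *\<^sub>C (T x - y))"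
    have "\<exists>!x\<in>UNIV. F x = x"
    proof (rule Banach_fix[OF complete_UNIV _ \<kappa>(1,2)])
      fix x z
      have "F x - F z = (x - z) - (of_real \<rho> * d) *\<^sub>C T (x - z)"
        by (simp add: F_def clinear_diff[OF T] complex_vector.scale_right_diff_distrib)
      then show "dist (F x) (F z) \<le> \<kappa> * dist x z"
        using contraction[of "x - z"] by (simp add: dist_norm)
    qed auto
    moreover have "F x = x \<longleftrightarrow> T x = y" for x
    proof (cases "T x = y")
      case True then show ?thesis by (simp add: F_def)
    next
      case False
      then have "T x - y \<noteq> 0" by simp
      then show ?thesis using d[of "T x - y"] \<rho> by (simp add: F_def)
    qed
    ultimately show ?thesis by simp
  qed
  then obtain B where TB: "\<And>y. T (B y) = y" and uniq: "\<And>x y. T x = y \<Longrightarrow> x = B y"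
    by metis
  have lower: "norm x \<le> (cmod d / c) * norm (T x)" for x
  proof (cases "norm x = 0")
    case False
    have "c * (norm x)\<^sup>2 \<le> cmod (d * cinner (T x) x)"
      using coercive[of x] complex_Re_le_cmod[of "d * cinner (T x) x"] by linarith
    also have "\<dots> \<le> cmod d * (norm (T x) * norm x)"
      by (simp add: norm_mult cauchy_schwarz mult_left_mono)
    finally have "c * norm x \<le> cmod d * norm (T x)"
      using False by (simp add: power2_eq_square mult.assoc[symmetric])
    then show ?thesis using c by (simp add: field_simps)
  qed (use c in simp)
  have "bounded_clinear B"
  proof (rule bounded_clinear_intro)
    show "B (x + y) = B x + B y" for x y
      by (rule uniq[symmetric]) (simp add: clinear_add[OF T] TB)
    show "B (a *\<^sub>C x) = a *\<^sub>C B x" for a x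
      by (rule uniq[symmetric]) (simp add: clinear_scaleC[OF T] TB)
    show "norm (B x) \<le> (cmod d / c) * norm x" for x
      using lower[of "B x"] by (simp add: TB)
  qed
  moreover have "B (T x) = x" for x by (rule uniq[symmetric]) simp
  ultimately show ?thesis using TB by blast
qed

lemma op_spectrum_subset_interval:
  fixes A :: "'a::chilbert_space \<Rightarrow> 'a"
  assumes A: "positive_op A" and K: "\<And>x. norm (A x) \<le> K * norm x"
    and z: "z \<in> op_spectrum A"
  shows "\<exists>t\<in>{0..K}. z = of_real t"
proof (rule ccontr)
  assume out: "\<not> ?thesis"
  have lin: "bounded_clinear A"
    using A by (simp add: positive_op_def selfadjoint_op_def)
  define T where "T = (\<lambda>x. A x - z *\<^sub>C x)"
  have T: "bounded_clinear T"
    unfolding T_def by (intro bounded_clinear_diff bounded_clinear_scaleC lin)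
  define \<alpha> where "\<alpha> x = Re (cinner (A x) x)" for x
  have A\<alpha>: "cinner (A x) x = of_real (\<alpha> x)" and \<alpha>0: "\<alpha> x \<ge> 0" for x
    using A by (auto simp: positive_op_def \<alpha>_def complex_nonneg_Reals_iff complex_eq_iff)
  have \<alpha>K: "\<alpha> x \<le> K * (norm x)\<^sup>2" for x
  proof -
    have "\<alpha> x \<le> norm (A x) * norm x"
      using complex_Re_le_cmod[of "cinner (A x) x"] cauchy_schwarz[of "A x" x]
      by (simp add: \<alpha>_def)
    also have "\<dots> \<le> (K * norm x) * norm x" by (rule mult_right_mono[OF K]) simp
    finally show ?thesis by (simp add: power2_eq_square)
  qed
  have inner: "cinner (T x) x = of_real (\<alpha> x) - z * of_real ((norm x)\<^sup>2)" for x
    by (simp add: T_def cinner_diff_left cinner_scaleC_left A\<alpha> cinner_norm)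
  \<comment> \<open>A suitable rotation makes \<open>A - z\<close> coercive: the numerical range of \<open>A\<close> is in \<open>[0, K]\<close>.\<close>
  have "\<exists>d c. c > 0 \<and> (\<forall>x. c * (norm x)\<^sup>2 \<le> Re (d * cinner (T x) x))"
  proof -
    consider "Im z \<noteq> 0" | "Im z = 0" "Re z < 0" | "Im z = 0" "Re z > K"
      using out by (cases "Im z = 0") (force simp: complex_eq_iff not_le)+
    then show ?thesis
    proof cases
      case 1
      have "Im z * sgn (Im z) = \<bar>Im z\<bar>" by (simp add: sgn_if abs_if)
      then have "Re (\<i> * of_real (sgn (Im z)) * cinner (T x) x) = \<bar>Im z\<bar> * (norm x)\<^sup>2" for x
        by (simp add: inner mult_ac flip: of_real_power)
      then show ?thesis using 1
        by (intro exI[of _ "\<i> * of_real (sgn (Im z))"] exI[of _ "\<bar>Im z\<bar>"]) simp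
    next
      case 2
      then show ?thesis
        by (intro exI[of _ "1"] exI[of _ "- Re z"]) (simp add: inner \<alpha>0)
    next
      case 3
      have "(Re z - K) * (norm x)\<^sup>2 \<le> Re (- 1 * cinner (T x) x)" for x
        using \<alpha>K[of x] by (simp add: inner algebra_simps)
      then show ?thesis using 3
        by (intro exI[of _ "- 1"] exI[of _ "Re z - K"]) auto
    qed
  qed
  then obtain d c where "c > 0" "\<And>x. c * (norm x)\<^sup>2 \<le> Re (d * cinner (T x) x)" by blast
  from coercive_op_invertible[OF T this] obtain B where
    B: "bounded_clinear B" "\<And>x. B (T x) = x" "\<And>x. T (B x) = x" by blast
  then have "z \<notin> op_spectrum A" by (auto simp: op_spectrum_def T_def)
  then show False using z by simp
qed

section \<open>The norm of a polynomial of a positive operator\<close>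

lemma op_poly_bounded_below:
  fixes A :: "'a::complex_inner \<Rightarrow> 'a"
  assumes A: "bounded_clinear A"
  shows "r \<noteq> 0 \<Longrightarrow> (\<And>z. poly r z = 0 \<Longrightarrow> z \<notin> op_spectrum A) \<Longrightarrow>
    \<exists>C>0. \<forall>x. norm x \<le> C * norm (op_poly r A x)"
proof (induction "degree r" arbitrary: r rule: less_induct)
  case less
  show ?case
  proof (cases "degree r = 0")
    case True
    then obtain a where a: "r = [:a:]" by (rule degree_eq_zeroE)
    then have "a \<noteq> 0" using less.prems(1) by auto
    then show ?thesis
      by (intro exI[of _ "inverse (cmod a)"]) (auto simp: a op_poly_pCons norm_scaleC simp flip: mult.assoc)
  next
    case False
    then have "\<not> constant (poly r)" by (simp add: constant_degree)
    then obtain z where z: "poly r z = 0" using fundamental_theorem_of_algebra by blast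
    then obtain s where s: "r = [:- z, 1:] * s" by (auto simp: poly_eq_0_iff_dvd)
    have s0: "s \<noteq> 0" using less.prems(1) s by auto
    have deg: "degree s < degree r"
      using s0 by (simp add: s degree_mult_eq del: mult_pCons_left)
    have "w \<notin> op_spectrum A" if "poly s w = 0" for w
      using that by (intro less.prems(2)) (simp add: s)
    from less.hyps[OF deg s0 this] obtain C where
      C: "C > 0" "\<And>x. norm x \<le> C * norm (op_poly s A x)" by blast
    obtain B where B: "bounded_clinear B" "\<And>x. B (A x - z *\<^sub>C x) = x"
      using less.prems(2)[OF z] by (auto simp: op_spectrum_def)
    obtain L where L: "L > 0" "\<And>x. norm (B x) \<le> norm x * L"
      using bounded_linear.pos_bounded[OF bounded_linear_clinear[OF B(1)]] by blast
    have "norm x \<le> (C * L) * norm (op_poly r A x)" for x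
    proof -
      let ?y = "op_poly s A x"
      have "op_poly r A x = A ?y - z *\<^sub>C ?y"
        unfolding s op_poly_mult[OF A] by (simp add: op_poly_pCons scaleC_one)
      then have "norm ?y \<le> norm (op_poly r A x) * L"
        using L(2)[of "A ?y - z *\<^sub>C ?y"] B(2)[of ?y] by simp
      then have "C * norm ?y \<le> C * (norm (op_poly r A x) * L)"
        using C(1) by simp
      then show ?thesis using C(2)[of x] by (simp add: mult_ac)
    qed
    then show ?thesis using C(1) L(1) by (intro exI[of _ "C * L"]) auto
  qed
qed

lemma norm_adjoint_le:
  fixes S T :: "'a::complex_inner \<Rightarrow> 'a"
  assumes adj: "\<And>x y. cinner (T x) y = cinner x (S y)"
    and N: "\<And>x. norm (T x) \<le> N * norm x"
  shows "norm (S y) \<le> N * norm y"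
proof (cases "S y = 0")
  case True
  have "0 \<le> N * norm y" using N[of y] norm_ge_zero[of "T y"] by linarith
  then show ?thesis using True by simp
next
  case False
  have "(norm (S y))\<^sup>2 = Re (cinner (T (S y)) y)"
    by (simp add: adj norm_square_cinner)
  also have "\<dots> \<le> norm (T (S y)) * norm y"
    using complex_Re_le_cmod[of "cinner (T (S y)) y"] cauchy_schwarz[of "T (S y)" y] by simp
  also have "\<dots> \<le> (N * norm (S y)) * norm y" by (rule mult_right_mono[OF N]) simp
  finally show ?thesis using False by (simp add: power2_eq_square mult_ac)
qed

text \<open>If \<open>N = \<parallel>q(A)\<parallel>\<close>, then \<open>q\<^sup>* q - N\<^sup>2\<close> evaluated at \<open>A\<close> is not bounded below, because
  vectors on which \<open>q(A)\<close> nearly attains its norm are approximate eigenvectors of \<open>q(A)\<^sup>* q(A)\<close>.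
  Splitting this polynomial into linear factors shows that one of its roots is in the spectrum,
  and \<open>|q| = N\<close> at this root because it is real.\<close>

lemma op_norm_attained_on_spectrum:
  fixes A :: "'a::chilbert_space \<Rightarrow> 'a"
  assumes A: "positive_op A" and N: "N = onorm (op_poly q A)" "N > 0"
    and nonconst: "map_poly cnj q * q \<noteq> [:of_real (N\<^sup>2):]"
  shows "\<exists>z\<in>op_spectrum A. cmod (poly q z) = N"
proof (rule ccontr)
  assume none: "\<not> ?thesis"
  have sa: "selfadjoint_op A" and lin: "bounded_clinear A"
    using A by (auto simp: positive_op_def selfadjoint_op_def)
  define r where "r = map_poly cnj q * q - [:of_real (N\<^sup>2):]"
  have r0: "r \<noteq> 0" using nonconst by (simp add: r_def)
  have "z \<notin> op_spectrum A" if "poly r z = 0" for z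
  proof
    assume z: "z \<in> op_spectrum A"
    obtain t where t: "z = of_real t"
      using op_spectrum_subset_interval[OF A _ z, of "onorm A"]
        onorm[OF bounded_linear_clinear[OF lin]] by blast
    have "of_real ((cmod (poly q z))\<^sup>2) = complex_of_real (N\<^sup>2)"
      using that unfolding t r_def complex_norm_square by (simp add: poly_map_cnj mult.commute)
    then have "cmod (poly q z) = N"
      using N(2) by (metis less_imp_le norm_ge_zero of_real_eq_iff power2_eq_imp_eq)
    then show False using none z by blast
  qed
  from op_poly_bounded_below[OF lin r0 this] obtain C where
    C: "C > 0" "\<And>x. norm x \<le> C * norm (op_poly r A x)" by blast
  have bound: "norm (op_poly q A x) \<le> N * norm x" for x
    unfolding N by (rule onorm) (rule bounded_linear_clinear[OF bounded_clinear_op_poly[OF lin]])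
  have gap: "(norm (op_poly q A x))\<^sup>2 \<le> (N\<^sup>2 - 1 / (C\<^sup>2 * N\<^sup>2)) * (norm x)\<^sup>2" for x
  proof -
    define y where "y = op_poly q A x"
    let ?s = "op_poly (map_poly cnj q) A"
    have "norm (?s y) \<le> N * norm y"
      by (rule norm_adjoint_le[OF op_poly_adjoint[OF sa] bound])
    then have sy: "(norm (?s y))\<^sup>2 \<le> N\<^sup>2 * (norm y)\<^sup>2"
      by (metis norm_ge_zero power_mono power_mult_distrib)
    have "cinner y y = cinner x (?s y)" unfolding y_def by (rule op_poly_adjoint[OF sa])
    then have re: "Re (cinner (?s y) x) = (norm y)\<^sup>2"
      by (subst cinner_commute) (simp add: norm_square_cinner)
    have ev: "op_poly r A x = ?s y - of_real (N\<^sup>2) *\<^sub>C x"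
      by (simp add: r_def op_poly_diff op_poly_mult[OF lin] op_poly_pCons y_def)
    have "(norm (op_poly r A x))\<^sup>2 = (norm (?s y))\<^sup>2 - 2 * N\<^sup>2 * (norm y)\<^sup>2 + N\<^sup>2 * N\<^sup>2 * (norm x)\<^sup>2"
    proof -
      have "Re (cinner (?s y) (of_real (N\<^sup>2) *\<^sub>C x)) = N\<^sup>2 * (norm y)\<^sup>2"
        using re by (simp add: cinner_scaleC_right flip: of_real_power)
      moreover have "norm (complex_of_real (N\<^sup>2) *\<^sub>C x) = N\<^sup>2 * norm x"
        by (simp add: norm_scaleC norm_power)
      ultimately show ?thesis unfolding ev norm_diff_square by (simp add: power2_eq_square)
    qed
    also have "\<dots> \<le> N\<^sup>2 * (N\<^sup>2 * (norm x)\<^sup>2 - (norm y)\<^sup>2)"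
      using sy by (simp add: algebra_simps)
    finally have r: "(norm (op_poly r A x))\<^sup>2 \<le> N\<^sup>2 * (N\<^sup>2 * (norm x)\<^sup>2 - (norm y)\<^sup>2)" .
    have "(norm x)\<^sup>2 \<le> C\<^sup>2 * (norm (op_poly r A x))\<^sup>2"
      using power_mono[OF C(2)[of x], of 2] by (simp add: power_mult_distrib)
    also have "\<dots> \<le> C\<^sup>2 * (N\<^sup>2 * (N\<^sup>2 * (norm x)\<^sup>2 - (norm y)\<^sup>2))"
      using r by (rule mult_left_mono) simp
    finally have "(norm x)\<^sup>2 / (C\<^sup>2 * N\<^sup>2) \<le> N\<^sup>2 * (norm x)\<^sup>2 - (norm y)\<^sup>2"
      using C(1) N(2) by (simp add: field_simps)
    then show ?thesis by (simp add: y_def algebra_simps)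
  qed
  define N' where "N' = sqrt (max 0 (N\<^sup>2 - 1 / (C\<^sup>2 * N\<^sup>2)))"
  have "norm (op_poly q A x) \<le> N' * norm x" for x
  proof (rule power2_le_imp_le)
    have "(N\<^sup>2 - 1 / (C\<^sup>2 * N\<^sup>2)) * (norm x)\<^sup>2 \<le> max 0 (N\<^sup>2 - 1 / (C\<^sup>2 * N\<^sup>2)) * (norm x)\<^sup>2"
      by (rule mult_right_mono) auto
    then show "(norm (op_poly q A x))\<^sup>2 \<le> (N' * norm x)\<^sup>2"
      using gap[of x] by (simp add: N'_def power_mult_distrib)
  qed (simp add: N'_def)
  then have "N \<le> N'" unfolding N(1) by (intro onorm_bound) (simp_all add: N'_def)
  moreover have "N'\<^sup>2 < N\<^sup>2" using C(1) N(2) by (simp add: N'_def max_def)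
  then have "N' < N" by (rule power2_less_imp_less) (use N in simp)
  ultimately show False by simp
qed

lemma op_poly_norm_le_spectrum:
  fixes A :: "'a::chilbert_space \<Rightarrow> 'a"
  assumes A: "positive_op A" and c: "c \<ge> 0"
    and q: "\<And>z. z \<in> op_spectrum A \<Longrightarrow> cmod (poly q z) \<le> c"
  shows "norm (op_poly q A x) \<le> c * norm x"
proof (rule ccontr)
  assume neg: "\<not> ?thesis"
  have lin: "bounded_clinear A"
    using A by (auto simp: positive_op_def selfadjoint_op_def)
  have bl: "bounded_linear (op_poly q A)" for q
    by (rule bounded_linear_clinear[OF bounded_clinear_op_poly[OF lin]])
  define N where "N = onorm (op_poly q A)"
  have x0: "x \<noteq> 0" using neg clinear_zero[OF bounded_clinear_op_poly[OF lin]] by auto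
  have "c * norm x < N * norm x"
    using neg onorm[OF bl, of q x] by (simp add: N_def)
  then have cN: "c < N" using x0 by simp
  have NN: "N = onorm (op_poly q A)" "N > 0" using cN c by (auto simp: N_def)
  show False
  proof (cases "map_poly cnj q * q = [:of_real (N\<^sup>2):]")
    case False
    from op_norm_attained_on_spectrum[OF A NN False] show False using q cN by force
  next
    \<comment> \<open>A constant \<open>q\<close> gives no polynomial to factor; it only matters that the spectrum is not empty.\<close>
    case True
    have "q \<noteq> 0" using True NN by auto
    then have "map_poly cnj q \<noteq> 0" by (simp add: map_poly_eq_0_iff)
    then have "degree (map_poly cnj q * q) = degree (map_poly cnj q) + degree q"
      using \<open>q \<noteq> 0\<close> by (rule degree_mult_eq)
    then have "degree q = 0" using True by simp
    then obtain d where d: "q = [:d:]" by (rule degree_eq_zeroE)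
    have "N = cmod d"
    proof (rule antisym)
      show "N \<le> cmod d" unfolding N_def
        by (rule onorm_bound) (simp_all add: d op_poly_pCons norm_scaleC)
      have "cmod d * norm x \<le> N * norm x"
        using onorm[OF bl, of q x] by (simp add: N_def d op_poly_pCons norm_scaleC)
      then show "cmod d \<le> N" using x0 by simp
    qed
    moreover have "\<exists>z. z \<in> op_spectrum A"
    proof (cases "onorm (op_poly [:0, 1:] A) = 0")
      case True
      have "op_poly [:0, 1:] A y = 0" for y
        using onorm[OF bl, of "[:0, 1:]" y] True by simp
      then have "A y = 0" for y by (simp add: op_poly_pCons scaleC_one)
      moreover have "B 0 = 0" if "bounded_clinear B" for B :: "'a \<Rightarrow> 'a"
        by (rule clinear_zero[OF that])
      ultimately have "0 \<in> op_spectrum A" using x0 by (auto simp: op_spectrum_def)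
      then show ?thesis ..
    next
      case False
      then have "onorm (op_poly [:0, 1:] A) > 0"
        using onorm_pos_le[OF bl, of "[:0, 1:]"] by simp
      then show ?thesis
        using op_norm_attained_on_spectrum[OF A refl, of "[:0, 1:]"] by (auto simp: map_poly_pCons)
    qed
    ultimately show False using q cN d by force
  qed
qed

section \<open>Continuous functions of a positive operator\<close>

text \<open>\<open>function_of A K g B\<close> says \<open>B = g(A)\<close> for a function \<open>g\<close> on an interval \<open>[0, K]\<close> that contains
  the spectrum. The approximating polynomials are only asked to be close to \<open>g\<close> on this interval
  and at the level \<open>e\<close>: this makes the algebraic rules short to prove, and no sequences occur.\<close>

definition function_of :: "('a::complex_inner \<Rightarrow> 'a) \<Rightarrow> real \<Rightarrow> (real \<Rightarrow> real) \<Rightarrow> ('a \<Rightarrow> 'a) \<Rightarrow> bool"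
  where "function_of A K g B \<longleftrightarrow> bounded_clinear B \<and>
    (\<forall>e>0. \<exists>q. (\<forall>t\<in>{0..K}. cmod (poly q (of_real t) - of_real (g t)) \<le> e) \<and>
      (\<forall>x. norm (op_poly q A x - B x) \<le> e * norm x))"

lemma function_ofD:
  assumes "function_of A K g B" "e > 0"
  obtains q where "\<And>t. t \<in> {0..K} \<Longrightarrow> cmod (poly q (of_real t) - of_real (g t)) \<le> e"
    and "\<And>x. norm (op_poly q A x - B x) \<le> e * norm x"
  using assms unfolding function_of_def by blast

lemma le_of_le_epsilon_mult:
  fixes a b c :: real
  assumes "\<And>e. e > 0 \<Longrightarrow> a \<le> b + e * c"
  shows "a \<le> b"
proof (rule field_le_epsilon)
  fix e :: real assume e: "e > 0"
  have "e / (\<bar>c\<bar> + 1) > 0" using e by (simp add: add_nonneg_pos)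
  then have "a \<le> b + (e / (\<bar>c\<bar> + 1)) * c" by (rule assms)
  also have "(e / (\<bar>c\<bar> + 1)) * c \<le> e"
  proof -
    have "e * c \<le> e * (\<bar>c\<bar> + 1)" using e by (intro mult_left_mono) auto
    then show ?thesis by (simp add: field_simps)
  qed
  finally show "a \<le> b + e" by simp
qed

lemma real_poly_approx:
  fixes g :: "real \<Rightarrow> real"
  assumes "continuous_on {0..b} g" "e > 0"
  obtains q where "\<And>t. t \<in> {0..b} \<Longrightarrow> \<bar>poly q t - g t\<bar> \<le> e"
proof -
  obtain h where h: "real_polynomial_function h" "\<And>t. t \<in> {0..b} \<Longrightarrow> \<bar>g t - h t\<bar> < e"
    using Stone_Weierstrass_real_polynomial_function[OF compact_Icc assms] by blast
  then obtain a n where an: "h = (\<lambda>x. \<Sum>i\<le>n. a i * x ^ i)"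
    unfolding real_polynomial_function_iff_sum by blast
  have "poly (\<Sum>i\<le>n. monom (a i) i) t = h t" for t by (simp add: an poly_sum poly_monom)
  then show ?thesis using h(2) that[of "\<Sum>i\<le>n. monom (a i) i"] by (force simp: abs_minus_commute)
qed

lemma poly_map_of_real: "poly (map_poly of_real q) (of_real t) = complex_of_real (poly q t)"
  by (induction q) (simp_all add: map_poly_pCons)

lemma function_of_clinear: "function_of A K g B \<Longrightarrow> bounded_clinear B"
  by (simp add: function_of_def)

lemma positive_op_clinear: "positive_op A \<Longrightarrow> bounded_clinear A"
  by (simp add: positive_op_def selfadjoint_op_def)

context
  fixes A :: "'a::chilbert_space \<Rightarrow> 'a" and K :: real
  assumes A: "positive_op A" and K: "\<And>x. norm (A x) \<le> K * norm x"
begin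

lemma op_poly_norm_le:
  assumes c: "c \<ge> 0" and q: "\<And>t. t \<in> {0..K} \<Longrightarrow> cmod (poly q (of_real t)) \<le> c"
  shows "norm (op_poly q A x) \<le> c * norm x"
proof (rule op_poly_norm_le_spectrum[OF A c])
  fix z assume "z \<in> op_spectrum A"
  then obtain t where "t \<in> {0..K}" "z = of_real t"
    using op_spectrum_subset_interval[OF A K] by blast
  then show "cmod (poly q z) \<le> c" using q by simp
qed

lemma function_of_norm_le:
  assumes g: "function_of A K g B" and c: "c \<ge> 0" "\<And>t. t \<in> {0..K} \<Longrightarrow> \<bar>g t\<bar> \<le> c"
  shows "norm (B x) \<le> c * norm x"
proof (rule le_of_le_epsilon_mult)
  fix e :: real assume e: "e > 0"
  obtain q where q: "\<And>t. t \<in> {0..K} \<Longrightarrow> cmod (poly q (of_real t) - of_real (g t)) \<le> e"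
    "\<And>x. norm (op_poly q A x - B x) \<le> e * norm x"
    using function_ofD[OF g e] by blast
  have "norm (op_poly q A x) \<le> (c + e) * norm x"
  proof (rule op_poly_norm_le)
    fix t assume t: "t \<in> {0..K}"
    show "cmod (poly q (of_real t)) \<le> c + e"
      using norm_triangle_sub[of "poly q (of_real t)" "complex_of_real (g t)"] q(1)[OF t] c(2)[OF t]
      by simp
  qed (use c e in simp)
  moreover have "norm (B x) \<le> norm (op_poly q A x) + norm (op_poly q A x - B x)"
    using norm_triangle_sub[of "B x" "op_poly q A x"] by (simp add: norm_minus_commute)
  ultimately show "norm (B x) \<le> c * norm x + e * (2 * norm x)"
    using q(2)[of x] by (simp add: algebra_simps)
qed

lemma function_of_poly:
  assumes "\<And>t. t \<in> {0..K} \<Longrightarrow> poly q (of_real t) = of_real (g t)"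
  shows "function_of A K g (op_poly q A)"
  unfolding function_of_def
  using assms by (auto intro!: exI[of _ q] bounded_clinear_op_poly positive_op_clinear[OF A])

lemma function_of_diff:
  assumes g: "function_of A K g B" and h: "function_of A K h C"
  shows "function_of A K (\<lambda>t. g t - h t) (\<lambda>x. B x - C x)"
  unfolding function_of_def
proof (intro conjI allI impI)
  show "bounded_clinear (\<lambda>x. B x - C x)"
    using g h by (auto simp: function_of_def intro: bounded_clinear_diff)
  fix e :: real assume "e > 0"
  then have e: "e / 2 > 0" by simp
  obtain q where q: "\<And>t. t \<in> {0..K} \<Longrightarrow> cmod (poly q (of_real t) - of_real (g t)) \<le> e / 2"
    "\<And>x. norm (op_poly q A x - B x) \<le> e / 2 * norm x"
    using function_ofD[OF g e] by blast
  obtain r where r: "\<And>t. t \<in> {0..K} \<Longrightarrow> cmod (poly r (of_real t) - of_real (h t)) \<le> e / 2"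
    "\<And>x. norm (op_poly r A x - C x) \<le> e / 2 * norm x"
    using function_ofD[OF h e] by blast
  show "\<exists>q. (\<forall>t\<in>{0..K}. cmod (poly q (of_real t) - of_real (g t - h t)) \<le> e) \<and>
      (\<forall>x. norm (op_poly q A x - (B x - C x)) \<le> e * norm x)"
  proof (intro exI[of _ "q - r"] conjI ballI allI)
    fix t assume t: "t \<in> {0..K}"
    have "poly (q - r) (of_real t) - of_real (g t - h t)
      = (poly q (of_real t) - of_real (g t)) - (poly r (of_real t) - complex_of_real (h t))"
      by simp
    also have "cmod \<dots> \<le> e / 2 + e / 2"
      by (rule order_trans[OF norm_triangle_ineq4 add_mono[OF q(1)[OF t] r(1)[OF t]]])
    finally show "cmod (poly (q - r) (of_real t) - of_real (g t - h t)) \<le> e" by simp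
  next
    fix x
    have "op_poly (q - r) A x - (B x - C x) = (op_poly q A x - B x) - (op_poly r A x - C x)"
      by (simp add: op_poly_diff)
    also have "norm \<dots> \<le> e / 2 * norm x + e / 2 * norm x"
      by (rule order_trans[OF norm_triangle_ineq4 add_mono[OF q(2) r(2)]])
    finally show "norm (op_poly (q - r) A x - (B x - C x)) \<le> e * norm x" by simp
  qed
qed

lemma function_of_unique:
  assumes "function_of A K g B" "function_of A K h C" "\<And>t. t \<in> {0..K} \<Longrightarrow> g t = h t"
  shows "B = C"
proof
  fix x
  have "norm (B x - C x) \<le> 0 * norm x"
    by (rule function_of_norm_le[OF function_of_diff[OF assms(1,2)]]) (use assms(3) in auto)
  then show "B x = C x" by simp
qed

lemma function_of_bounded:
  assumes "function_of A K g B"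
  obtains c where "c > 0" "\<And>t. t \<in> {0..K} \<Longrightarrow> \<bar>g t\<bar> \<le> c"
proof -
  obtain q where q: "\<And>t. t \<in> {0..K} \<Longrightarrow> cmod (poly q (of_real t) - of_real (g t)) \<le> 1"
    using function_ofD[OF assms zero_less_one] by blast
  have "compact ((\<lambda>t. poly q (complex_of_real t)) ` {0..K})"
    by (intro compact_continuous_image continuous_intros) auto
  then obtain b where b: "b > 0" "\<And>t. t \<in> {0..K} \<Longrightarrow> cmod (poly q (of_real t)) \<le> b"
    using bounded_pos[of "(\<lambda>t. poly q (complex_of_real t)) ` {0..K}"] compact_imp_bounded by auto
  have "\<bar>g t\<bar> \<le> b + 1" if t: "t \<in> {0..K}" for t
    using norm_triangle_sub[of "complex_of_real (g t)" "poly q (of_real t)"] b(2)[OF t] q[OF t]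
    by (simp add: norm_minus_commute)
  then show ?thesis using that[of "b + 1"] b(1) by auto
qed

lemma function_of_mult:
  assumes g: "function_of A K g B" and h: "function_of A K h C"
  shows "function_of A K (\<lambda>t. g t * h t) (\<lambda>x. B (C x))"
  unfolding function_of_def
proof (intro conjI allI impI)
  have Bl: "bounded_clinear B" and Cl: "bounded_clinear C"
    using g h by (auto simp: function_of_def)
  then show "bounded_clinear (\<lambda>x. B (C x))" by (rule bounded_clinear_compose)
  fix e :: real assume e: "e > 0"
  obtain b where b: "b > 0" "\<And>t. t \<in> {0..K} \<Longrightarrow> \<bar>g t\<bar> \<le> b" using function_of_bounded[OF g] by blast
  obtain c where c: "c > 0" "\<And>t. t \<in> {0..K} \<Longrightarrow> \<bar>h t\<bar> \<le> c" using function_of_bounded[OF h] by blast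
  \<comment> \<open>Chosen so that \<open>\<delta> (c + \<delta>) + b \<delta> \<le> e\<close>.\<close>
  define \<delta> where "\<delta> = min 1 (e / (b + c + 1))"
  have \<delta>: "\<delta> > 0" "\<delta> \<le> 1" using b c e by (auto simp: \<delta>_def)
  have "\<delta> * (b + c + 1) \<le> e / (b + c + 1) * (b + c + 1)"
    using b c by (intro mult_right_mono) (auto simp: \<delta>_def)
  then have \<delta>e: "\<delta> * (b + c + 1) \<le> e" using b c by simp
  have small: "\<delta> * (c + \<delta>) + b * \<delta> \<le> e"
  proof -
    have "\<delta> * \<delta> \<le> \<delta> * 1" using \<delta> by (intro mult_left_mono) auto
    then show ?thesis using \<delta>e by (simp add: algebra_simps)
  qed
  obtain q where q: "\<And>t. t \<in> {0..K} \<Longrightarrow> cmod (poly q (of_real t) - of_real (g t)) \<le> \<delta>"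
    "\<And>x. norm (op_poly q A x - B x) \<le> \<delta> * norm x"
    using function_ofD[OF g \<delta>(1)] by blast
  obtain r where r: "\<And>t. t \<in> {0..K} \<Longrightarrow> cmod (poly r (of_real t) - of_real (h t)) \<le> \<delta>"
    "\<And>x. norm (op_poly r A x - C x) \<le> \<delta> * norm x"
    using function_ofD[OF h \<delta>(1)] by blast
  show "\<exists>q. (\<forall>t\<in>{0..K}. cmod (poly q (of_real t) - of_real (g t * h t)) \<le> e) \<and>
      (\<forall>x. norm (op_poly q A x - B (C x)) \<le> e * norm x)"
  proof (intro exI[of _ "q * r"] conjI ballI allI)
    fix t assume t: "t \<in> {0..K}"
    let ?q = "poly q (complex_of_real t)" and ?r = "poly r (complex_of_real t)"
    have "cmod ?r \<le> c + \<delta>"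
      using norm_triangle_sub[of ?r "complex_of_real (h t)"] r(1)[OF t] c(2)[OF t] by simp
    then have 1: "cmod ((?q - of_real (g t)) * ?r) \<le> \<delta> * (c + \<delta>)"
      unfolding norm_mult using q(1)[OF t] \<delta> by (intro mult_mono) auto
    have 2: "cmod (of_real (g t) * (?r - of_real (h t))) \<le> b * \<delta>"
      unfolding norm_mult using r(1)[OF t] b(2)[OF t] b(1) by (intro mult_mono) auto
    have "poly (q * r) (of_real t) - of_real (g t * h t)
      = (?q - of_real (g t)) * ?r + of_real (g t) * (?r - of_real (h t))"
      by (simp add: algebra_simps)
    also have "cmod \<dots> \<le> \<delta> * (c + \<delta>) + b * \<delta>" by (rule norm_triangle_le[OF add_mono[OF 1 2]])
    finally show "cmod (poly (q * r) (of_real t) - of_real (g t * h t)) \<le> e" using small by simp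
  next
    fix x
    let ?r = "op_poly r A x"
    have "norm (C x) \<le> c * norm x" by (rule function_of_norm_le[OF h]) (use c in auto)
    then have "norm ?r \<le> (c + \<delta>) * norm x"
      using norm_triangle_sub[of ?r "C x"] r(2)[of x] by (simp add: algebra_simps)
    then have "\<delta> * norm ?r \<le> \<delta> * ((c + \<delta>) * norm x)"
      using \<delta>(1) by (intro mult_left_mono) auto
    then have 1: "norm (op_poly q A ?r - B ?r) \<le> \<delta> * ((c + \<delta>) * norm x)"
      using q(2)[of ?r] by linarith
    have "norm (B (?r - C x)) \<le> b * norm (?r - C x)"
      by (rule function_of_norm_le[OF g]) (use b in auto)
    also have "\<dots> \<le> b * (\<delta> * norm x)" using r(2)[of x] b(1) by (intro mult_left_mono) auto
    finally have 2: "norm (B ?r - B (C x)) \<le> b * (\<delta> * norm x)" by (simp add: clinear_diff[OF Bl])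
    have "op_poly (q * r) A x - B (C x) = (op_poly q A ?r - B ?r) + (B ?r - B (C x))"
      by (simp add: op_poly_mult[OF positive_op_clinear[OF A]])
    also have "norm \<dots> \<le> \<delta> * ((c + \<delta>) * norm x) + b * (\<delta> * norm x)"
      by (rule norm_triangle_le[OF add_mono[OF 1 2]])
    also have "\<dots> = (\<delta> * (c + \<delta>) + b * \<delta>) * norm x" by (simp add: algebra_simps)
    also have "\<dots> \<le> e * norm x" using small by (rule mult_right_mono) simp
    finally show "norm (op_poly (q * r) A x - B (C x)) \<le> e * norm x" .
  qed
qed

lemma function_of_id: "function_of A K (\<lambda>t. t) A"
proof -
  have "op_poly [:0, 1:] A = A" by (auto simp: op_poly_pCons scaleC_one)
  then show ?thesis using function_of_poly[of "[:0, 1:]" "\<lambda>t. t"] by simp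
qed

lemma function_of_one: "function_of A K (\<lambda>t. 1) (\<lambda>x. x)"
proof -
  have "op_poly 1 A = (\<lambda>x. x)" by (auto simp: one_pCons op_poly_pCons scaleC_one)
  then show ?thesis using function_of_poly[of 1 "\<lambda>t. 1"] by simp
qed

lemma function_of_funpow:
  assumes "function_of A K g B"
  shows "function_of A K (\<lambda>t. g t ^ n) (B ^^ n)"
proof (induction n)
  case 0
  then show ?case using function_of_one by (simp add: id_def)
next
  case (Suc n)
  then show ?case using function_of_mult[OF assms Suc] by (simp add: o_def)
qed

text \<open>For real \<open>g\<close>, a polynomial \<open>q\<close> and its conjugate \<open>q\<^sup>*\<close> approximate \<open>g\<close> equally well.\<close>

lemma function_of_selfadjoint:
  assumes g: "function_of A K g B"
  shows "selfadjoint_op B"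
  unfolding selfadjoint_op_def
proof (intro conjI allI)
  show "bounded_clinear B" by (rule function_of_clinear[OF g])
  fix x y
  have sa: "selfadjoint_op A" using A by (simp add: positive_op_def)
  have "cmod (cinner (B x) y - cinner x (B y)) \<le> 0"
  proof (rule le_of_le_epsilon_mult)
    fix e :: real assume e: "e > 0"
    obtain q where q: "\<And>t. t \<in> {0..K} \<Longrightarrow> cmod (poly q (of_real t) - of_real (g t)) \<le> e"
      "\<And>x. norm (op_poly q A x - B x) \<le> e * norm x"
      using function_ofD[OF g e] by blast
    let ?q' = "map_poly cnj q"
    have "norm (op_poly (?q' - q) A y) \<le> (2 * e) * norm y"
    proof (rule op_poly_norm_le)
      fix t assume t: "t \<in> {0..K}"
      let ?w = "poly q (complex_of_real t)"
      have "poly (?q' - q) (of_real t) = cnj (?w - of_real (g t)) - (?w - of_real (g t))"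
        by (simp add: poly_map_cnj)
      also have "cmod \<dots> \<le> e + e"
      proof -
        have "cmod (cnj (?w - of_real (g t))) \<le> e" using q(1)[OF t] by (simp only: complex_mod_cnj)
        then show ?thesis by (rule order_trans[OF norm_triangle_ineq4 add_mono[OF _ q(1)[OF t]]])
      qed
      finally show "cmod (poly (?q' - q) (of_real t)) \<le> 2 * e" by simp
    qed (use e in simp)
    moreover have "op_poly ?q' A y - B y = op_poly (?q' - q) A y + (op_poly q A y - B y)"
      by (simp add: op_poly_diff)
    ultimately have 1: "norm (op_poly ?q' A y - B y) \<le> 3 * e * norm y"
      using norm_triangle_ineq[of "op_poly (?q' - q) A y" "op_poly q A y - B y"] q(2)[of y]
      by (simp only: mult.assoc)
    have "cinner (B x) y - cinner x (B y)
        = cinner x (op_poly ?q' A y - B y) - cinner (op_poly q A x - B x) y"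
      by (simp add: cinner_diff_left cinner_diff_right op_poly_adjoint[OF sa])
    also have "cmod \<dots> \<le> norm x * (3 * e * norm y) + (e * norm x) * norm y"
      by (rule order_trans[OF norm_triangle_ineq4 add_mono[OF
            order_trans[OF cauchy_schwarz mult_left_mono[OF 1 norm_ge_zero]]
            order_trans[OF cauchy_schwarz mult_right_mono[OF q(2) norm_ge_zero]]]])
    finally show "cmod (cinner (B x) y - cinner x (B y)) \<le> 0 + e * (4 * (norm x * norm y))"
      by (simp add: algebra_simps)
  qed
  then show "cinner (B x) y = cinner x (B y)" by simp
qed

text \<open>A polynomial of \<open>B = g(A)\<close> is a function of \<open>A\<close>; this transfers approximations
  from \<open>B\<close> to \<open>A\<close>.\<close>

lemma op_poly_function_of_norm_le:
  assumes g: "function_of A K g B" and h: "function_of A K h C" and c: "c \<ge> 0"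
    and q: "\<And>t. t \<in> {0..K} \<Longrightarrow> \<bar>poly q (g t) - h t\<bar> \<le> c"
  shows "norm (op_poly (map_poly of_real q) B x - C x) \<le> c * norm x"
proof -
  have "function_of A K (\<lambda>t. poly q (g t)) (op_poly (map_poly of_real q) B)"
  proof (induction q)
    case 0
    have "op_poly 0 A = (\<lambda>x. 0)" "op_poly (map_poly of_real 0) B = (\<lambda>x. 0)" by auto
    then show ?case using function_of_poly[of 0 "\<lambda>t. 0"] by simp
  next
    case (pCons a q)
    have "op_poly [:- of_real a:] A = (\<lambda>x. - (of_real a *\<^sub>C x))" by (auto simp: op_poly_pCons)
    then have "function_of A K (\<lambda>t. - a) (\<lambda>x. - (of_real a *\<^sub>C x))"
      using function_of_poly[of "[:- of_real a:]" "\<lambda>t. - a"] by simp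
    from function_of_diff[OF function_of_mult[OF pCons(2) g] this]
    show ?case
      by (simp add: map_poly_pCons op_poly_pCons[abs_def] mult.commute add.commute)
  qed
  from function_of_norm_le[OF function_of_diff[OF this h] c q] show ?thesis by simp
qed

lemma function_of_exists:
  assumes g: "continuous_on {0..K} g"
  shows "\<exists>B. function_of A K g B"
proof -
  have "\<exists>q. \<forall>t\<in>{0..K}. \<bar>poly q t - g t\<bar> \<le> 1 / Suc n" for n
  proof -
    have "0 < 1 / real (Suc n)" by simp
    from real_poly_approx[OF g this]
    obtain q where "\<And>t. t \<in> {0..K} \<Longrightarrow> \<bar>poly q t - g t\<bar> \<le> 1 / Suc n" by metis
    then show ?thesis by blast
  qed
  then obtain q where q: "\<And>n t. t \<in> {0..K} \<Longrightarrow> \<bar>poly (q n) t - g t\<bar> \<le> 1 / Suc n" by metis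
  define r where "r n = (map_poly of_real (q n) :: complex poly)" for n
  have r: "cmod (poly (r n) (of_real t) - of_real (g t)) \<le> 1 / Suc n" if "t \<in> {0..K}" for n t
    using q[OF that, of n] by (simp add: r_def poly_map_of_real flip: of_real_diff)
  have diff: "norm (op_poly (r m) A x - op_poly (r n) A x) \<le> (1 / Suc m + 1 / Suc n) * norm x" for m n x
  proof -
    have "norm (op_poly (r m - r n) A x) \<le> (1 / Suc m + 1 / Suc n) * norm x"
    proof (rule op_poly_norm_le)
      fix t assume t: "t \<in> {0..K}"
      have "poly (r m - r n) (of_real t)
        = (poly (r m) (of_real t) - of_real (g t)) - (poly (r n) (of_real t) - complex_of_real (g t))"
        by simp
      also have "cmod \<dots> \<le> 1 / Suc m + 1 / Suc n"
        by (rule order_trans[OF norm_triangle_ineq4 add_mono[OF r[OF t] r[OF t]]])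
      finally show "cmod (poly (r m - r n) (of_real t)) \<le> 1 / Suc m + 1 / Suc n" .
    qed simp
    then show ?thesis by (simp add: op_poly_diff)
  qed
  define T where "T n = Blinfun (op_poly (r n) A)" for n
  have T: "blinfun_apply (T n) = op_poly (r n) A" for n
    unfolding T_def
    by (intro bounded_linear_Blinfun_apply bounded_linear_clinear bounded_clinear_op_poly
        positive_op_clinear[OF A])
  have "Cauchy T"
  proof (rule metric_CauchyI)
    fix e :: real assume "e > 0"
    then obtain N where N: "1 / Suc N < e / 2"
      using nat_approx_posE[of "e / 2"] by auto
    have "dist (T m) (T n) < e" if "m \<ge> N" "n \<ge> N" for m n
    proof -
      have "norm (T m - T n) \<le> 1 / Suc m + 1 / Suc n"
        by (rule norm_blinfun_bound) (use diff in \<open>simp_all add: blinfun.diff_left T\<close>)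
      also have "\<dots> \<le> 1 / Suc N + 1 / Suc N"
        using that by (intro add_mono divide_left_mono) auto
      finally show ?thesis using N by (simp add: dist_norm)
    qed
    then show "\<exists>N. \<forall>m\<ge>N. \<forall>n\<ge>N. dist (T m) (T n) < e" by blast
  qed
  then obtain L where L: "T \<longlonglongrightarrow> L" using Cauchy_convergent_iff convergent_def by blast
  define B where "B = blinfun_apply L"
  have lim: "(\<lambda>n. op_poly (r n) A x) \<longlonglongrightarrow> B x" for x
    using tendsto_intros(1)[of x] bounded_bilinear.tendsto[OF bounded_bilinear_blinfun_apply L tendsto_const[of x]]
    by (simp add: T B_def)
  have "bounded_clinear B"
    unfolding bounded_clinear_def
  proof (intro conjI allI)
    show "bounded_linear B" unfolding B_def by (rule blinfun.bounded_linear_right)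
    fix c x
    have "(\<lambda>n. c *\<^sub>C op_poly (r n) A x) \<longlonglongrightarrow> c *\<^sub>C B x"
      by (rule bounded_linear.tendsto[OF bounded_linear_clinear[OF bounded_clinear_scaleC] lim])
    then have "(\<lambda>n. op_poly (r n) A (c *\<^sub>C x)) \<longlonglongrightarrow> c *\<^sub>C B x"
      by (simp add: clinear_scaleC[OF bounded_clinear_op_poly[OF positive_op_clinear[OF A]]])
    then show "B (c *\<^sub>C x) = c *\<^sub>C B x" using LIMSEQ_unique lim by blast
  qed
  moreover have "norm (op_poly (r m) A x - B x) \<le> 1 / Suc m * norm x" for m x
  proof (rule LIMSEQ_le)
    show "(\<lambda>n. norm (op_poly (r m) A x - op_poly (r n) A x)) \<longlonglongrightarrow> norm (op_poly (r m) A x - B x)"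
      by (intro tendsto_intros lim)
    show "(\<lambda>n. (1 / Suc m + 1 / Suc n) * norm x) \<longlonglongrightarrow> 1 / Suc m * norm x"
      by (rule tendsto_eq_rhs[OF tendsto_mult[OF tendsto_add[OF tendsto_const
              LIMSEQ_inverse_real_of_nat[unfolded inverse_eq_divide]] tendsto_const]]) simp
    show "\<exists>N. \<forall>n\<ge>N. norm (op_poly (r m) A x - op_poly (r n) A x) \<le> (1 / Suc m + 1 / Suc n) * norm x"
      using diff by blast
  qed
  ultimately have "function_of A K g B"
    unfolding function_of_def
  proof (intro conjI allI impI)
    fix e :: real assume e: "e > 0"
      and close: "\<And>m x. norm (op_poly (r m) A x - B x) \<le> 1 / Suc m * norm x"
    obtain n where n: "1 / Suc n < e" using nat_approx_posE[OF e] by auto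
    have "norm (op_poly (r n) A x - B x) \<le> e * norm x" for x
      using close[of n x] mult_right_mono[OF less_imp_le[OF n] norm_ge_zero[of x]] by linarith
    moreover have "cmod (poly (r n) (of_real t) - of_real (g t)) \<le> e" if "t \<in> {0..K}" for t
      using r[OF that, of n] n by linarith
    ultimately show "\<exists>q. (\<forall>t\<in>{0..K}. cmod (poly q (of_real t) - of_real (g t)) \<le> e) \<and>
      (\<forall>x. norm (op_poly q A x - B x) \<le> e * norm x)" by blast
  qed
  then show ?thesis by blast
qed

text \<open>The defining property of \<open>cfc\<close> determines the operator because the norm of a polynomial of
  \<open>A\<close> is controlled by its values on the spectrum alone.\<close>

lemma cfc_eqI:
  assumes g: "function_of A K g B"
  shows "cfc A (\<lambda>z. of_real (g (Re z))) = B"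
proof -
  let ?P = "\<lambda>q B. uniform_limit (op_spectrum A) (\<lambda>n. poly (q n)) (\<lambda>z. complex_of_real (g (Re z))) sequentially
    \<and> (\<lambda>n. onorm (\<lambda>x. op_poly (q n) A x - B x)) \<longlonglongrightarrow> 0"
  note lin = positive_op_clinear[OF A]
  have spec: "\<exists>t\<in>{0..K}. z = of_real t" if "z \<in> op_spectrum A" for z
    using op_spectrum_subset_interval[OF A K that] .
  have bl: "bounded_linear (\<lambda>x. op_poly q A x - C x)" if "bounded_clinear C" for q C
    by (intro bounded_linear_clinear bounded_clinear_diff bounded_clinear_op_poly lin that)
  show ?thesis
    unfolding cfc_def
  proof (rule the_equality)
    have "\<exists>q. (\<forall>t\<in>{0..K}. cmod (poly q (of_real t) - of_real (g t)) \<le> 1 / Suc n) \<and>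
      (\<forall>x. norm (op_poly q A x - B x) \<le> 1 / Suc n * norm x)" for n
    proof -
      have "0 < 1 / real (Suc n)" by simp
      then show ?thesis using g unfolding function_of_def by meson
    qed
    then obtain q where
      q: "\<And>n t. t \<in> {0..K} \<Longrightarrow> cmod (poly (q n) (of_real t) - of_real (g t)) \<le> 1 / Suc n"
      "\<And>n x. norm (op_poly (q n) A x - B x) \<le> 1 / Suc n * norm x" by metis
    have inv: "(\<lambda>n. 1 / real (Suc n)) \<longlonglongrightarrow> 0"
      using LIMSEQ_inverse_real_of_nat by (simp add: inverse_eq_divide)
    have "uniform_limit (op_spectrum A) (\<lambda>n. poly (q n)) (\<lambda>z. of_real (g (Re z))) sequentially"
    proof (rule uniform_limitI)
      fix e :: real assume "e > 0"
      then have "\<forall>\<^sub>F n in sequentially. 1 / real (Suc n) < e"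
        using inv by (rule order_tendstoD(2)[rotated])
      then show "\<forall>\<^sub>F n in sequentially. \<forall>z\<in>op_spectrum A. dist (poly (q n) z) (of_real (g (Re z))) < e"
      proof eventually_elim
        case (elim n)
        then show ?case using q(1)[of _ n] spec by (fastforce simp: dist_norm)
      qed
    qed
    moreover have "(\<lambda>n. onorm (\<lambda>x. op_poly (q n) A x - B x)) \<longlonglongrightarrow> 0"
    proof (rule tendsto_sandwich[OF _ _ tendsto_const inv])
      show "\<forall>\<^sub>F n in sequentially. 0 \<le> onorm (\<lambda>x. op_poly (q n) A x - B x)"
        by (intro always_eventually allI onorm_pos_le bl function_of_clinear[OF g])
      show "\<forall>\<^sub>F n in sequentially. onorm (\<lambda>x. op_poly (q n) A x - B x) \<le> 1 / real (Suc n)"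
        by (intro always_eventually allI onorm_bound q(2)) simp
    qed
    ultimately show "bounded_clinear B \<and> (\<exists>q. ?P q B)"
      using function_of_clinear[OF g] by blast
  next
    fix C assume "bounded_clinear C \<and> (\<exists>q. ?P q C)"
    then obtain q where C: "bounded_clinear C" and
      u: "uniform_limit (op_spectrum A) (\<lambda>n. poly (q n)) (\<lambda>z. of_real (g (Re z))) sequentially" and
      o: "(\<lambda>n. onorm (\<lambda>x. op_poly (q n) A x - C x)) \<longlonglongrightarrow> 0" by blast
    show "C = B"
    proof
      fix x
      have "norm (C x - B x) \<le> 0"
      proof (rule le_of_le_epsilon_mult)
        fix e :: real assume e: "e > 0"
        have "\<forall>\<^sub>F n in sequentially. (\<forall>z\<in>op_spectrum A. dist (poly (q n) z) (of_real (g (Re z))) < e)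
            \<and> onorm (\<lambda>x. op_poly (q n) A x - C x) < e"
          by (intro eventually_conj uniform_limitD[OF u e] order_tendstoD(2)[OF o e])
        then obtain n where n: "\<And>z. z \<in> op_spectrum A \<Longrightarrow> dist (poly (q n) z) (of_real (g (Re z))) < e"
          "onorm (\<lambda>x. op_poly (q n) A x - C x) < e"
          by (auto simp: eventually_sequentially)
        obtain r where r: "\<And>t. t \<in> {0..K} \<Longrightarrow> cmod (poly r (of_real t) - of_real (g t)) \<le> e"
          "\<And>x. norm (op_poly r A x - B x) \<le> e * norm x"
          using function_ofD[OF g e] by blast
        have "norm (op_poly (q n - r) A x) \<le> (2 * e) * norm x"
        proof (rule op_poly_norm_le_spectrum[OF A])
          fix z assume z: "z \<in> op_spectrum A"
          then obtain t where t: "t \<in> {0..K}" "z = of_real t" using spec by blast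
          have "poly (q n - r) z = (poly (q n) z - of_real (g t)) - (poly r z - of_real (g t))" by simp
          also have "cmod \<dots> \<le> e + e"
            using n(1)[OF z] r(1)[OF t(1)]
            by (intro order_trans[OF norm_triangle_ineq4 add_mono]) (simp_all add: dist_norm t(2))
          finally show "cmod (poly (q n - r) z) \<le> 2 * e" by simp
        qed (use e in simp)
        moreover have "norm (op_poly (q n) A x - C x) \<le> e * norm x"
          using onorm[OF bl[OF C], of "q n" x] mult_right_mono[OF less_imp_le[OF n(2)] norm_ge_zero[of x]]
          by linarith
        moreover have "C x - B x = op_poly (q n - r) A x + (op_poly r A x - B x) - (op_poly (q n) A x - C x)"
          by (simp add: op_poly_diff)
        ultimately show "norm (C x - B x) \<le> 0 + e * (4 * norm x)"
          using r(2)[of x] norm_triangle_ineq[of "op_poly (q n - r) A x" "op_poly r A x - B x"]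
            norm_triangle_ineq4[of "op_poly (q n - r) A x + (op_poly r A x - B x)" "op_poly (q n) A x - C x"]
          by (simp add: algebra_simps)
      qed
      then show "C x = B x" by simp
    qed
  qed
qed

lemma function_of_powr:
  assumes "s > 0"
  shows "function_of A K (\<lambda>t. t powr s) (op_powr A s)"
proof -
  have "continuous_on {0..K} (\<lambda>t. t powr s)"
    using assms by (intro continuous_on_powr') (auto intro: continuous_intros)
  from function_of_exists[OF this] obtain B where B: "function_of A K (\<lambda>t. t powr s) B" ..
  from cfc_eqI[OF this] have "op_powr A s = B" by (simp add: op_powr_def)
  then show ?thesis using B by simp
qed

lemma positive_op_powr:
  assumes "s > 0"
  shows "positive_op (op_powr A s)"
  unfolding positive_op_def
proof (intro conjI allI)
  let ?R = "op_powr A (s / 2)"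
  have s2: "s / 2 > 0" using assms by simp
  show "selfadjoint_op (op_powr A s)"
    by (rule function_of_selfadjoint[OF function_of_powr[OF assms]])
  have sa: "selfadjoint_op ?R" by (rule function_of_selfadjoint[OF function_of_powr[OF s2]])
  have "op_powr A s = (\<lambda>x. ?R (?R x))"
    by (rule function_of_unique[OF function_of_powr[OF assms]
          function_of_mult[OF function_of_powr[OF s2] function_of_powr[OF s2]]])
      (simp flip: powr_add)
  then have "cinner (op_powr A s x) x = of_real ((norm (?R x))\<^sup>2)" for x
    using sa by (simp add: selfadjoint_op_def cinner_norm)
  then show "cinner (op_powr A s x) x \<in> \<real>\<^sub>\<ge>\<^sub>0" for x by (simp del: of_real_power)
qed

lemma op_powr_funpow_op_powr:
  assumes "u > 0" "s > 0"
  shows "(op_powr A u ^^ k) (op_powr A s x) = op_powr A (u * real k + s) x"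
proof -
  have us: "u * real k + s > 0" using assms by (simp add: add_nonneg_pos)
  have "(t powr u) ^ k * t powr s = t powr (u * real k + s)" if "t \<in> {0..K}" for t
  proof (cases "t = 0")
    case False
    then have "(t powr u) ^ k = (t powr u) powr real k" by (simp add: powr_realpow)
    then show ?thesis by (simp add: powr_add powr_powr)
  qed (use us in simp)
  from function_of_unique[OF function_of_mult[OF function_of_funpow[OF function_of_powr[OF assms(1)]]
        function_of_powr[OF assms(2)]] function_of_powr[OF us] this]
  show ?thesis by (simp add: fun_eq_iff)
qed

lemma op_powr_one: "op_powr A 1 = A"
  by (rule function_of_unique[OF function_of_powr function_of_id]) auto

text \<open>If \<open>q\<close> is close to \<open>t \<mapsto> t\<^bsup>1/s\<^esup>\<close>, then \<open>q(t\<^sup>s)\<close> is close to \<open>t\<close> on \<open>[0, K]\<close>.\<close>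

lemma polys_of_op_powr_approximate:
  assumes s: "s > 0" and e: "e > 0"
  obtains q :: "real poly"
  where "\<And>t. t \<in> {0..K powr s} \<Longrightarrow> \<bar>poly q t - t powr (1 / s)\<bar> \<le> e"
    and "\<And>x. norm (op_poly (map_poly of_real q) (op_powr A s) x - A x) \<le> e * norm x"
proof -
  have "continuous_on {0..K powr s} (\<lambda>t. t powr (1 / s))"
    using s by (intro continuous_on_powr') (auto intro: continuous_intros)
  from real_poly_approx[OF this e]
  obtain q where q: "\<And>t. t \<in> {0..K powr s} \<Longrightarrow> \<bar>poly q t - t powr (1 / s)\<bar> \<le> e" by metis
  have "\<bar>poly q (t powr s) - t\<bar> \<le> e" if "t \<in> {0..K}" for t
    using q[of "t powr s"] that s by (auto simp: powr_powr powr_mono2)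
  then have "norm (op_poly (map_poly of_real q) (op_powr A s) x - A x) \<le> e * norm x" for x
    using e by (intro op_poly_function_of_norm_le[OF function_of_powr[OF s] function_of_id]) auto
  then show ?thesis using q that by blast
qed

lemma op_powr_norm_le:
  assumes "s > 0"
  shows "norm (op_powr A s x) \<le> K powr s * norm x"
  by (rule function_of_norm_le[OF function_of_powr[OF assms]])
    (use assms in \<open>auto intro: powr_mono2\<close>)

end

lemma op_powr_inverse:
  fixes A :: "'a::chilbert_space \<Rightarrow> 'a"
  assumes A: "positive_op A" and s: "s > 0"
  shows "op_powr (op_powr A s) (1 / s) = A"
proof -
  have lin: "bounded_clinear A" by (rule positive_op_clinear[OF A])
  let ?K = "onorm A"
  have K: "norm (A x) \<le> ?K * norm x" for x by (rule onorm[OF bounded_linear_clinear[OF lin]])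
  have "function_of (op_powr A s) (?K powr s) (\<lambda>t. t powr (1 / s)) A"
    unfolding function_of_def
  proof (intro conjI allI impI lin)
    fix e :: real assume e: "e > 0"
    obtain q where q: "\<And>t. t \<in> {0..?K powr s} \<Longrightarrow> \<bar>poly q t - t powr (1 / s)\<bar> \<le> e"
      "\<And>x. norm (op_poly (map_poly of_real q) (op_powr A s) x - A x) \<le> e * norm x"
      using polys_of_op_powr_approximate[OF A K s e] by metis
    have "cmod (poly (map_poly of_real q) (of_real t) - of_real (t powr (1 / s))) \<le> e"
      if "t \<in> {0..?K powr s}" for t
      unfolding poly_map_of_real of_real_diff[symmetric] norm_of_real by (rule q(1)[OF that])
    then show "\<exists>q. (\<forall>t\<in>{0..?K powr s}. cmod (poly q (of_real t) - of_real (t powr (1 / s))) \<le> e) \<and>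
      (\<forall>x. norm (op_poly q (op_powr A s) x - A x) \<le> e * norm x)"
      using q(2) by blast
  qed
  from cfc_eqI[OF positive_op_powr[OF A K s] op_powr_norm_le[OF A K s] this]
  show ?thesis by (simp add: op_powr_def[of "op_powr A s"])
qed

section \<open>The frame inequalities for an orbit\<close>

text \<open>In the frame sum the power acts on \<open>f i\<close>. For self-adjoint \<open>T\<close> it can be moved to \<open>x\<close>, and
  then applying \<open>T\<close> to \<open>x\<close> is a shift in \<open>n\<close>.\<close>

definition orbit_energy :: "('a::complex_inner \<Rightarrow> 'a) \<Rightarrow> ('i \<Rightarrow> 'a) \<Rightarrow> 'i set \<Rightarrow> 'a \<Rightarrow> nat \<Rightarrow> real"
  where "orbit_energy T f I x n = (\<Sum>i\<in>I. (cmod (cinner ((T ^^ n) x) (f i)))\<^sup>2)"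

lemma orbit_energy_nonneg: "0 \<le> orbit_energy T f I x n"
  by (simp add: orbit_energy_def sum_nonneg)

lemma orbit_energy_shift: "orbit_energy T f I ((T ^^ k) x) n = orbit_energy T f I x (n + k)"
  by (simp add: orbit_energy_def funpow_add)

lemma sum_over_nat_times_finite:
  fixes g :: "nat \<times> 'i \<Rightarrow> real"
  assumes I: "finite I" and g: "\<And>p. g p \<ge> 0"
  shows "g summable_on (UNIV \<times> I) \<longleftrightarrow> summable (\<lambda>n. \<Sum>i\<in>I. g (n, i))"
    and "g summable_on (UNIV \<times> I) \<Longrightarrow> infsum g (UNIV \<times> I) = (\<Sum>n. \<Sum>i\<in>I. g (n, i))"
proof -
  let ?E = "\<lambda>n. \<Sum>i\<in>I. g (n, i)"
  have fin: "infsum (\<lambda>i. g (n, i)) I = ?E n" for n using I by simp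
  have sums: "?E sums infsum g (UNIV \<times> I)" if "g summable_on (UNIV \<times> I)"
  proof -
    have "?E summable_on UNIV"
      using summable_on_Sigma_banach[of "\<lambda>n i. g (n, i)" UNIV "\<lambda>_. I"] that fin by simp
    moreover have "infsum ?E UNIV = infsum g (UNIV \<times> I)"
      using infsum_Sigma_banach[OF that] fin by simp
    ultimately have "(?E has_sum infsum g (UNIV \<times> I)) UNIV" by (metis has_sum_infsum)
    then show ?thesis by (rule has_sum_imp_sums)
  qed
  then show "g summable_on (UNIV \<times> I) \<Longrightarrow> infsum g (UNIV \<times> I) = suminf ?E"
    by (simp add: sums_iff)
  have "g summable_on (UNIV \<times> I)" if E: "summable ?E"
  proof (rule nonneg_bdd_above_summable_on)
    show "bdd_above (sum g ` {F. F \<subseteq> UNIV \<times> I \<and> finite F})"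
    proof (rule bdd_aboveI2)
      fix F assume F: "F \<in> {F. F \<subseteq> (UNIV::nat set) \<times> I \<and> finite F}"
      then have "finite (fst ` F)" by blast
      then obtain N where N: "fst ` F \<subseteq> {..<N}" using finite_nat_iff_bounded by blast
      have "sum g F \<le> sum g ({..<N} \<times> I)"
        by (rule sum_mono2) (use F N I g in auto)
      also have "\<dots> = (\<Sum>n<N. ?E n)" by (simp add: sum.cartesian_product)
      also have "\<dots> \<le> suminf ?E"
        using E g by (intro sum_le_suminf) (auto intro: sum_nonneg)
      finally show "sum g F \<le> suminf ?E" .
    qed
  qed (use g in simp)
  then show "g summable_on (UNIV \<times> I) \<longleftrightarrow> summable ?E"
    using sums by (auto simp: sums_iff)
qed

lemma is_frame_orbit_iff:
  assumes T: "selfadjoint_op T" and I: "finite I"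
  shows "is_frame (UNIV \<times> I) (\<lambda>(n, i). (T ^^ n) (f i)) \<longleftrightarrow>
    (\<exists>a b. 0 < a \<and> (\<forall>x. summable (orbit_energy T f I x) \<and>
       a * (norm x)\<^sup>2 \<le> suminf (orbit_energy T f I x) \<and>
       suminf (orbit_energy T f I x) \<le> b * (norm x)\<^sup>2))" (is "_ \<longleftrightarrow> ?R")
proof -
  let ?g = "\<lambda>x \<gamma>. (cmod (cinner x (case \<gamma> of (n, i) \<Rightarrow> (T ^^ n) (f i))))\<^sup>2"
  have E: "orbit_energy T f I x = (\<lambda>n. \<Sum>i\<in>I. ?g x (n, i))" for x
    by (simp add: orbit_energy_def fun_eq_iff selfadjoint_op_funpow[OF T])
  have s: "?g x summable_on (UNIV \<times> I) \<longleftrightarrow> summable (orbit_energy T f I x)" for x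
    unfolding E by (rule sum_over_nat_times_finite(1)[OF I]) simp
  have i: "infsum (?g x) (UNIV \<times> I) = suminf (orbit_energy T f I x)"
    if "summable (orbit_energy T f I x)" for x
    using sum_over_nat_times_finite(2)[OF I, of "?g x"] s[of x] that unfolding E by simp
  have "countable ((UNIV::nat set) \<times> I)" using I by (simp add: countable_finite)
  then have "is_frame (UNIV \<times> I) (\<lambda>(n, i). (T ^^ n) (f i)) \<longleftrightarrow>
    (\<exists>a b. 0 < a \<and> a \<le> b \<and> (\<forall>x. summable (orbit_energy T f I x) \<and>
       a * (norm x)\<^sup>2 \<le> suminf (orbit_energy T f I x) \<and>
       suminf (orbit_energy T f I x) \<le> b * (norm x)\<^sup>2))"
    unfolding is_frame_def using s i by (smt (verit))
  also have "\<dots> \<longleftrightarrow> ?R"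
  proof
    assume ?R
    then obtain a b where ab: "0 < a" "\<And>x. summable (orbit_energy T f I x)"
      "\<And>x. a * (norm x)\<^sup>2 \<le> suminf (orbit_energy T f I x)"
      "\<And>x. suminf (orbit_energy T f I x) \<le> b * (norm x)\<^sup>2" by blast
    have "suminf (orbit_energy T f I x) \<le> max a b * (norm x)\<^sup>2" for x
      by (rule order_trans[OF ab(4)]) (auto intro: mult_right_mono)
    then show "\<exists>a b. 0 < a \<and> a \<le> b \<and> (\<forall>x. summable (orbit_energy T f I x) \<and>
       a * (norm x)\<^sup>2 \<le> suminf (orbit_energy T f I x) \<and>
       suminf (orbit_energy T f I x) \<le> b * (norm x)\<^sup>2)"
      using ab by (intro exI[of _ a] exI[of _ "max a b"]) auto
  qed blast
  finally show ?thesis .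
qed

text \<open>The norms \<open>\<parallel>T\<^sup>n x\<parallel>\<close> form a log-convex sequence for self-adjoint \<open>T\<close>: once they increase, they
  grow geometrically.\<close>

lemma power_bounded_selfadjoint_contraction:
  fixes T :: "'a::complex_inner \<Rightarrow> 'a"
  assumes T: "selfadjoint_op T" and M: "\<And>n x. norm ((T ^^ n) x) \<le> M * norm x"
  shows "norm (T x) \<le> norm x"
proof (rule ccontr)
  assume neg: "\<not> norm (T x) \<le> norm x"
  define a where "a n = norm ((T ^^ n) x)" for n
  have lin: "bounded_clinear T" using T by (simp add: selfadjoint_op_def)
  have x: "norm x > 0" using neg clinear_zero[OF lin] by auto
  define \<rho> where "\<rho> = norm (T x) / norm x"
  have \<rho>: "\<rho> > 1" using neg x by (simp add: \<rho>_def)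
  have convex: "(a (Suc n))\<^sup>2 \<le> a n * a (Suc (Suc n))" for n
  proof -
    have "(a (Suc n))\<^sup>2 = Re (cinner ((T ^^ n) x) ((T ^^ Suc (Suc n)) x))"
      using T by (simp add: a_def norm_square_cinner selfadjoint_op_def)
    also have "\<dots> \<le> a n * a (Suc (Suc n))"
      unfolding a_def using complex_Re_le_cmod cauchy_schwarz order_trans by blast
    finally show ?thesis .
  qed
  have step: "a n > 0 \<and> \<rho> * a n \<le> a (Suc n)" for n
  proof (induction n)
    case 0
    then show ?case using x by (simp add: a_def \<rho>_def)
  next
    case (Suc n)
    then have pos: "a (Suc n) > 0" using \<rho> by (smt (verit) mult_pos_pos)
    have "\<rho> * a n * a (Suc n) \<le> a (Suc n) * a (Suc n)"
      using Suc pos by (intro mult_right_mono) auto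
    also have "\<dots> \<le> a n * a (Suc (Suc n))" using convex[of n] by (simp add: power2_eq_square)
    finally have "a n * (\<rho> * a (Suc n)) \<le> a n * a (Suc (Suc n))" by (simp add: mult_ac)
    then show ?case using Suc pos by simp
  qed
  have "\<rho> ^ n * norm x \<le> a n" for n
  proof (induction n)
    case 0 then show ?case by (simp add: a_def)
  next
    case (Suc n)
    then have "\<rho> * (\<rho> ^ n * norm x) \<le> \<rho> * a n" using \<rho> by (intro mult_left_mono) auto
    then show ?case using step[of n] by (simp add: mult.assoc)
  qed
  then have "\<rho> ^ n * norm x \<le> M * norm x" for n
    using M[of n x] unfolding a_def using order_trans by blast
  then have "\<rho> ^ n \<le> M" for n using x by simp
  moreover obtain n where "M < \<rho> ^ n" using real_arch_pow[OF \<rho>] by blast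
  ultimately show False by (simp add: not_le[symmetric])
qed

lemma orbit_frame_contraction:
  fixes T :: "'a::complex_inner \<Rightarrow> 'a"
  assumes T: "selfadjoint_op T" and a: "0 < a"
    and summable: "\<And>x. summable (orbit_energy T f I x)"
    and lower: "\<And>x. a * (norm x)\<^sup>2 \<le> suminf (orbit_energy T f I x)"
    and upper: "\<And>x. suminf (orbit_energy T f I x) \<le> b * (norm x)\<^sup>2"
  shows "norm (T x) \<le> norm x"
proof (rule power_bounded_selfadjoint_contraction[OF T])
  fix n x
  have "orbit_energy T f I ((T ^^ n) x) = (\<lambda>k. orbit_energy T f I x (k + n))"
    by (simp add: fun_eq_iff orbit_energy_shift)
  then have "a * (norm ((T ^^ n) x))\<^sup>2 \<le> (\<Sum>k. orbit_energy T f I x (k + n))"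
    using lower[of "(T ^^ n) x"] by simp
  also have "\<dots> = suminf (orbit_energy T f I x) - (\<Sum>k<n. orbit_energy T f I x k)"
    by (rule suminf_minus_initial_segment[OF summable])
  also have "\<dots> \<le> b * (norm x)\<^sup>2"
    using upper[of x] sum_nonneg[of "{..<n}" "orbit_energy T f I x"]
    by (simp add: orbit_energy_nonneg)
  finally have *: "(norm ((T ^^ n) x))\<^sup>2 \<le> b / a * (norm x)\<^sup>2" using a by (simp add: field_simps)
  show "norm ((T ^^ n) x) \<le> sqrt \<bar>b / a\<bar> * norm x"
  proof (rule power2_le_imp_le)
    have "b / a * (norm x)\<^sup>2 \<le> \<bar>b / a\<bar> * (norm x)\<^sup>2"
      by (rule mult_right_mono[OF abs_ge_self]) simp
    then show "(norm ((T ^^ n) x))\<^sup>2 \<le> (sqrt \<bar>b / a\<bar> * norm x)\<^sup>2"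
      using * by (simp only: power_mult_distrib real_sqrt_pow2 abs_ge_zero)
  qed simp
qed

section \<open>The binomial series for the powers of a positive contraction\<close>

lemma gchoose_Suc_eq: "(s gchoose Suc j) = (s gchoose j) * ((s - real j) / real (Suc j))"
  using gbinomial_mult_1[of s j] by (simp add: field_simps del: of_nat_Suc)

text \<open>For \<open>s \<ge> 1\<close> the numbers \<open>j\<^sup>2 |s choose j|\<close> decrease as soon as \<open>j \<ge> s\<close>. Hence the
  binomial coefficients have a summable majorant, uniformly for \<open>s\<close> in a bounded interval
  that stays away from \<open>0\<close>.\<close>

lemma gchoose_majorant:
  assumes W: "W \<ge> (1::real)"
  obtains c where "summable c" "\<And>j. 0 \<le> c j"
    "\<And>s j. 1 \<le> s \<Longrightarrow> s \<le> W \<Longrightarrow> \<bar>s gchoose j\<bar> \<le> c j"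
proof -
  define m where "m = nat \<lceil>W\<rceil> + 1"
  have m: "W \<le> real m" by (simp add: m_def) linarith
  define C where "C = (real m)\<^sup>2 * (W + 1) ^ m"
  have small: "\<bar>s gchoose j\<bar> \<le> (W + 1) ^ j" if "1 \<le> s" "s \<le> W" for s j
  proof (induction j)
    case (Suc j)
    have "\<bar>(s - real j) / real (Suc j)\<bar> \<le> W + 1"
    proof -
      have "\<bar>s - real j\<bar> \<le> W + real j" using that by linarith
      also have "\<dots> \<le> (W + 1) * real (Suc j)" using W by (simp add: algebra_simps)
      finally show ?thesis by (simp add: field_simps)
    qed
    then have "\<bar>s gchoose j\<bar> * \<bar>(s - real j) / real (Suc j)\<bar> \<le> (W + 1) ^ j * (W + 1)"
      using Suc W by (intro mult_mono) auto
    then show ?case by (simp add: gchoose_Suc_eq abs_mult mult.commute)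
  qed simp
  have pw: "(W + 1) ^ j \<le> (W + 1) ^ m" if "j \<le> m" for j
    using W that by (intro power_increasing) auto
  have large: "(real j)\<^sup>2 * \<bar>s gchoose j\<bar> \<le> C" if s: "1 \<le> s" "s \<le> W" for s j
  proof (induction j)
    case 0
    show ?case using W by (simp add: C_def)
  next
    case (Suc j)
    show ?case
    proof (cases "Suc j \<le> m")
      case True
      have "(real (Suc j))\<^sup>2 * \<bar>s gchoose Suc j\<bar> \<le> (real m)\<^sup>2 * (W + 1) ^ m"
        using True order_trans[OF small[OF s] pw[OF True]] by (intro mult_mono power_mono) auto
      also have "\<dots> \<le> C" using W by (simp add: C_def)
      finally show ?thesis .
    next
      case False
      then have j: "s \<le> real j" using m s by linarith
      have "(real (Suc j))\<^sup>2 * \<bar>s gchoose Suc j\<bar> = (real j + 1) * (real j - s) * \<bar>s gchoose j\<bar>"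
      proof -
        have "\<bar>s gchoose Suc j\<bar> = \<bar>s gchoose j\<bar> * ((real j - s) / real (Suc j))"
          using j by (simp add: gchoose_Suc_eq abs_mult abs_divide abs_minus_commute)
        then show ?thesis by (simp add: power2_eq_square)
      qed
      also have "\<dots> \<le> (real j)\<^sup>2 * \<bar>s gchoose j\<bar>"
      proof (rule mult_right_mono)
        have "(real j + 1) * (real j - s) \<le> (real j + 1) * (real j - 1)"
          using s by (intro mult_left_mono) auto
        then show "(real j + 1) * (real j - s) \<le> (real j)\<^sup>2"
          by (simp add: algebra_simps power2_eq_square)
      qed simp
      finally show ?thesis using Suc by linarith
    qed
  qed
  define c where "c j = (if j = 0 then 1 else C * inverse ((real j)\<^sup>2))" for j
  show ?thesis
  proof (rule that[of c])
    have "summable (\<lambda>j. C * inverse ((real j)\<^sup>2))"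
      by (intro summable_mult inverse_power_summable) simp
    then show "summable c"
      by (rule summable_cong[THEN iffD1, rotated])
        (auto simp: c_def eventually_sequentially intro!: exI[of _ 1])
    have "C \<ge> 0" using W by (simp add: C_def)
    then show "0 \<le> c j" for j by (simp add: c_def)
    show "\<bar>s gchoose j\<bar> \<le> c j" if "1 \<le> s" "s \<le> W" for s j
      using large[OF that, of j] by (simp add: c_def field_simps)
  qed
qed

text \<open>The point \<open>t = 0\<close> is on the boundary of the disc of convergence; it is reached by
  continuity in \<open>t\<close>, because the bound on the remainder does not depend on \<open>t\<close>.\<close>

lemma powr_binomial_remainder:
  assumes s: "1 \<le> s" and c: "summable c" "\<And>j. \<bar>s gchoose j\<bar> \<le> c j" and t: "t \<in> {0..1::real}"
  shows "\<bar>(\<Sum>j<J. (s gchoose j) * (t - 1) ^ j) - t powr s\<bar> \<le> suminf c - (\<Sum>j<J. c j)"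
proof -
  define h where "h t = \<bar>(\<Sum>j<J. (s gchoose j) * (t - 1) ^ j) - t powr s\<bar>" for t
  have cl: "closure {0<..1::real} = {0..1}" by (rule closure_greaterThanAtMost) simp
  have "h t \<le> suminf c - (\<Sum>j<J. c j)"
  proof (rule continuous_le_on_closure[of "{0<..1}" h t])
    show "continuous_on (closure {0<..1}) h"
      unfolding cl h_def using s by (intro continuous_intros continuous_on_powr') auto
    show "t \<in> closure {0<..1}" using t cl by simp
    fix u :: real assume u: "u \<in> {0<..1}"
    define g where "g j = (s gchoose j) * (u - 1) ^ j" for j
    have "g sums (1 + (u - 1)) powr s" unfolding g_def by (rule gen_binomial_real) (use u in auto)
    then have g: "summable g" "suminf g = u powr s" by (auto simp: sums_iff)
    have gc: "\<bar>g j\<bar> \<le> c j" for j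
    proof -
      have "\<bar>u - 1\<bar> ^ j \<le> 1" using u by (intro power_le_one) auto
      then have "\<bar>g j\<bar> \<le> \<bar>s gchoose j\<bar>"
        by (simp add: g_def abs_mult power_abs mult_left_le)
      then show ?thesis using c(2)[of j] by linarith
    qed
    have "h u = \<bar>\<Sum>j. g (j + J)\<bar>"
      unfolding suminf_minus_initial_segment[OF g(1)] g(2) by (simp add: h_def g_def)
    also have "\<dots> \<le> (\<Sum>j. c (j + J))"
      using norm_suminf_le[of "\<lambda>j. g (j + J)" "\<lambda>j. c (j + J)"] gc c(1)
      by (simp add: summable_iff_shift)
    also have "\<dots> = suminf c - (\<Sum>j<J. c j)" by (rule suminf_minus_initial_segment[OF c(1)])
    finally show "h u \<le> suminf c - (\<Sum>j<J. c j)" .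
  qed
  then show ?thesis by (simp add: h_def)
qed

lemma op_poly_sum: "op_poly (\<Sum>j\<in>S. q j) A x = (\<Sum>j\<in>S. op_poly (q j) A x)"
  by (induction S rule: infinite_finite_induct) (simp_all add: op_poly_add)

context
  fixes A :: "'a::chilbert_space \<Rightarrow> 'a"
  assumes A: "positive_op A" and contraction: "\<And>x. norm (A x) \<le> 1 * norm x"
begin

lemma op_powr_binomial_series:
  assumes s: "1 \<le> s" and c: "summable c" "\<And>j. \<bar>s gchoose j\<bar> \<le> c j"
  shows "(\<lambda>j. of_real (s gchoose j) *\<^sub>C op_poly ([:-1, 1:] ^ j) A x) sums op_powr A s x"
proof -
  let ?P = "\<lambda>J. \<Sum>j<J. smult (of_real (s gchoose j)) ([:-1, 1:] ^ j) :: complex poly"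
  let ?\<delta> = "\<lambda>J. suminf c - (\<Sum>j<J. c j)"
  have P: "poly (?P J) (of_real t) = of_real (\<Sum>j<J. (s gchoose j) * (t - 1) ^ j)" for J t
    by (simp add: poly_sum add.commute)
  have close: "norm (op_poly (?P J) A x - op_powr A s x) \<le> ?\<delta> J * norm x" for J
  proof (rule function_of_norm_le[OF A contraction])
    show "function_of A 1 (\<lambda>t. (\<Sum>j<J. (s gchoose j) * (t - 1) ^ j) - t powr s)
        (\<lambda>x. op_poly (?P J) A x - op_powr A s x)"
      using s P by (intro function_of_diff[OF A contraction] function_of_poly[OF A contraction]
          function_of_powr[OF A contraction]) auto
    show "0 \<le> ?\<delta> J"
      by (rule order_trans[OF abs_ge_zero powr_binomial_remainder[OF s c, of 1 J]]) simp
  qed (rule powr_binomial_remainder[OF s c])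
  have "(\<lambda>J. ?\<delta> J * norm x) \<longlonglongrightarrow> 0"
  proof -
    have "?\<delta> \<longlonglongrightarrow> suminf c - suminf c"
      by (intro tendsto_diff tendsto_const summable_LIMSEQ c)
    then show ?thesis using tendsto_mult_left_zero[of ?\<delta>] by simp
  qed
  then have "(\<lambda>J. op_poly (?P J) A x - op_powr A s x) \<longlonglongrightarrow> 0"
    by (rule Lim_null_comparison[OF always_eventually[OF allI[OF close]]])
  then have "(\<lambda>J. op_poly (?P J) A x) \<longlonglongrightarrow> op_powr A s x" by (rule LIM_zero_cancel)
  then show ?thesis by (simp add: sums_def op_poly_sum op_poly_smult)
qed

lemma norm_difference_power_le:
  "norm (op_poly ([:-1, 1:] ^ Suc j) A x) \<le> norm (A x - x)"
proof -
  have lin: "bounded_clinear A" by (rule positive_op_clinear[OF A])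
  have "op_poly ([:-1, 1:] ^ Suc j) A x = op_poly ([:-1, 1:] ^ j * [:-1, 1:]) A x"
    by (simp only: power_Suc2)
  also have "\<dots> = op_poly ([:-1, 1:] ^ j) A (A x - x)"
    unfolding op_poly_mult[OF lin] by (simp add: op_poly_pCons scaleC_one)
  also have "norm \<dots> \<le> 1 * norm (A x - x)"
  proof (rule op_poly_norm_le[OF A contraction])
    fix t :: real assume t: "t \<in> {0..1}"
    have "poly ([:-1, 1:] ^ j) (complex_of_real t) = of_real ((t - 1) ^ j)" by (simp add: add.commute)
    then have "cmod (poly ([:-1, 1:] ^ j) (complex_of_real t)) = \<bar>t - 1\<bar> ^ j"
      by (simp add: power_abs del: of_real_power of_real_diff)
    also have "\<dots> \<le> 1" using t by (intro power_le_one) auto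
    finally show "cmod (poly ([:-1, 1:] ^ j) (complex_of_real t)) \<le> 1" .
  qed simp
  finally show ?thesis by simp
qed

lemma norm_power_difference_le:
  "norm ((A ^^ n) (A x - x)) \<le> norm x / (real n + 1)"
proof -
  have lin: "bounded_clinear A" by (rule positive_op_clinear[OF A])
  let ?q = "monom 1 n * [:-1, 1:] :: complex poly"
  have "(A ^^ n) (A x - x) = op_poly ?q A x"
    unfolding op_poly_mult[OF lin] op_poly_monom[OF lin] by (simp add: op_poly_pCons scaleC_one)
  also have "norm \<dots> \<le> (1 / (real n + 1)) * norm x"
  proof (rule op_poly_norm_le[OF A contraction])
    fix t :: real assume t: "t \<in> {0..1}"
    have "poly ?q (complex_of_real t) = of_real (t ^ n * (t - 1))"
      by (simp add: poly_monom algebra_simps)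
    then have "cmod (poly ?q (complex_of_real t)) = t ^ n * (1 - t)"
      using t by (simp add: abs_mult del: of_real_mult of_real_power of_real_diff)
    also have "\<dots> \<le> 1 / (real n + 1)"
    proof -
      have "(real n + 1) * t ^ n = (\<Sum>k<Suc n. t ^ n)" by simp
      also have "\<dots> \<le> (\<Sum>k<Suc n. t ^ k)"
        using t by (intro sum_mono power_decreasing) auto
      finally have "(1 - t) * ((real n + 1) * t ^ n) \<le> (1 - t) * (\<Sum>k<Suc n. t ^ k)"
        using t by (intro mult_left_mono) auto
      also have "\<dots> = 1 - t ^ Suc n" by (rule one_diff_power_eq[symmetric])
      also have "\<dots> \<le> 1" using t by simp
      finally show ?thesis by (simp add: field_simps)
    qed
    finally show "cmod (poly ?q (complex_of_real t)) \<le> 1 / (real n + 1)" .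
  qed simp
  finally show ?thesis by simp
qed

end

section \<open>Comparing two sampling steps\<close>

lemma sum_over_fibres_le:
  fixes h :: "nat \<Rightarrow> real" and k :: "nat \<Rightarrow> nat"
  assumes h: "\<And>m. h m \<ge> 0" and D: "\<And>m. card {n. n < N \<and> k n = m} \<le> D"
    and B: "\<And>M. (\<Sum>m<M. h m) \<le> B"
  shows "(\<Sum>n<N. h (k n)) \<le> real D * B"
proof -
  have "finite (k ` {..<N})" by simp
  then obtain M where M: "k ` {..<N} \<subseteq> {..<M}" unfolding finite_nat_iff_bounded by blast
  have "(\<Sum>n<N. h (k n)) = (\<Sum>m\<in>k ` {..<N}. \<Sum>n | n \<in> {..<N} \<and> k n = m. h (k n))"
    by (rule sum.image_gen) simp
  also have "\<dots> = (\<Sum>m\<in>k ` {..<N}. real (card {n. n < N \<and> k n = m}) * h m)"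
    by (intro sum.cong refl) simp
  also have "\<dots> \<le> (\<Sum>m\<in>k ` {..<N}. real D * h m)"
    using D h by (intro sum_mono mult_right_mono) auto
  also have "\<dots> \<le> (\<Sum>m<M. real D * h m)"
    using M h by (intro sum_mono2) auto
  also have "\<dots> = real D * (\<Sum>m<M. h m)" by (simp add: sum_distrib_left)
  also have "\<dots> \<le> real D * B" using B by (intro mult_left_mono) auto
  finally show ?thesis .
qed

lemma card_le_of_diameter:
  fixes S :: "nat set"
  assumes "finite S" and d: "\<And>m n. m \<in> S \<Longrightarrow> n \<in> S \<Longrightarrow> real n - real m < real d"
  shows "card S \<le> d"
proof (cases "S = {}")
  case False
  have "S \<subseteq> {Min S..<Min S + d}"
  proof
    fix n assume n: "n \<in> S"
    have "real n - real (Min S) < real d" using d[OF Min_in n] assms(1) False by simp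
    then show "n \<in> {Min S..<Min S + d}" using n assms(1) by auto
  qed
  then show ?thesis using card_mono[of "{Min S..<Min S + d}" S] by simp
qed simp

lemma norm_sum_scale_square_le:
  fixes z :: "nat \<Rightarrow> complex"
  assumes c: "\<And>j. 0 \<le> c j" "\<And>j. cmod (\<beta> j) \<le> c j"
  shows "(cmod (\<Sum>j<J. \<beta> j * z j))\<^sup>2 \<le> (\<Sum>j<J. c j) * (\<Sum>j<J. c j * (cmod (z j))\<^sup>2)"
proof -
  have "cmod (\<Sum>j<J. \<beta> j * z j) \<le> (\<Sum>j<J. c j * cmod (z j))"
    by (rule sum_norm_le) (simp add: norm_mult c mult_right_mono)
  also have "\<dots> = (\<Sum>j<J. sqrt (c j) * (sqrt (c j) * cmod (z j)))"
    using c by (simp flip: mult.assoc)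
  finally have "(cmod (\<Sum>j<J. \<beta> j * z j))\<^sup>2 \<le> (\<Sum>j<J. sqrt (c j) * (sqrt (c j) * cmod (z j)))\<^sup>2"
    by (rule power_mono) simp
  also have "\<dots> \<le> (\<Sum>j<J. (sqrt (c j))\<^sup>2) * (\<Sum>j<J. (sqrt (c j) * cmod (z j))\<^sup>2)"
    by (rule Cauchy_Schwarz_ineq_sum)
  finally show ?thesis using c by (simp add: power_mult_distrib)
qed

text \<open>The exponents \<open>s n\<close> may vary with the sampling point. The binomial series separates the
  variable: \<open>A\<^sup>s x - x\<close> is a combination of the fixed vectors \<open>(A - 1)\<^sup>j x\<close>, \<open>j \<ge> 1\<close>, with
  coefficients that are dominated by a summable sequence independent of \<open>s\<close>, and the Bessel
  bound applies to each of these vectors.\<close>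

lemma perturbed_samples_energy:
  fixes A :: "'a::chilbert_space \<Rightarrow> 'a"
  assumes A: "positive_op A" and contraction: "\<And>x. norm (A x) \<le> 1 * norm x" and W: "W \<ge> (1::real)"
  shows "\<exists>C\<ge>0. \<forall>B f b D (k :: nat \<Rightarrow> nat) s x N. bounded_clinear B \<longrightarrow>
    (\<forall>y N. (\<Sum>m<N. (cmod (cinner ((B ^^ m) y) f))\<^sup>2) \<le> b * (norm y)\<^sup>2) \<longrightarrow>
    (\<forall>m. card {n. n < N \<and> k n = m} \<le> D) \<longrightarrow> (\<forall>n. 1 \<le> s n \<and> s n \<le> W) \<longrightarrow>
    (\<Sum>n<N. (cmod (cinner ((B ^^ k n) (op_powr A (s n) x - x)) f))\<^sup>2)
      \<le> C * (real D * (b * (norm (A x - x))\<^sup>2))"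
proof -
  obtain c where c: "summable c" "\<And>j. 0 \<le> c j"
    "\<And>s j. 1 \<le> s \<Longrightarrow> s \<le> W \<Longrightarrow> \<bar>s gchoose j\<bar> \<le> c j" by (rule gchoose_majorant[OF W]) blast
  let ?C = "(\<Sum>j. c (Suc j))"
  have c': "summable (\<lambda>j. c (Suc j))" using c(1) by (simp add: summable_Suc_iff)
  have C0: "?C \<ge> 0" by (intro suminf_nonneg c' c)
  have C: "(\<Sum>j<J. c (Suc j)) \<le> ?C" for J by (intro sum_le_suminf c') (auto simp: c)
  have "(\<Sum>n<N. (cmod (cinner ((B ^^ k n) (op_powr A (s n) x - x)) f))\<^sup>2)
      \<le> ?C * ?C * (real D * (b * (norm (A x - x))\<^sup>2))"
    if B: "bounded_clinear B"
      and bessel: "\<forall>y N. (\<Sum>m<N. (cmod (cinner ((B ^^ m) y) f))\<^sup>2) \<le> b * (norm y)\<^sup>2"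
      and D: "\<forall>m. card {n. n < N \<and> k n = m} \<le> D" and s: "\<forall>n. 1 \<le> s n \<and> s n \<le> W"
    for B :: "'a \<Rightarrow> 'a" and f b D s x N and k :: "nat \<Rightarrow> nat"
  proof -
    define d where "d j = op_poly ([:-1, 1:] ^ Suc j) A x" for j
    define \<beta> where "\<beta> n j = complex_of_real (s n gchoose Suc j)" for n j
    let ?r = "real D * (b * (norm (A x - x))\<^sup>2)"
    have b0: "0 \<le> b * (norm y)\<^sup>2" for y :: 'a using bessel[rule_format, of y 0] by simp
    have r0: "0 \<le> ?r" using b0 by simp
    have lin: "bounded_clinear (B ^^ m)" for m by (rule bounded_clinear_funpow[OF B])
    have series: "(\<lambda>j. \<beta> n j *\<^sub>C d j) sums (op_powr A (s n) x - x)" for n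
    proof -
      have "(\<lambda>j. of_real (s n gchoose j) *\<^sub>C op_poly ([:-1, 1:] ^ j) A x) sums op_powr A (s n) x"
        by (rule op_powr_binomial_series[OF A contraction _ c(1)]) (use s c in auto)
      from sums_split_initial_segment[OF this, of 1] show ?thesis
        by (simp add: \<beta>_def d_def one_pCons op_poly_pCons scaleC_one)
    qed
    have lim: "(\<lambda>J. cinner ((B ^^ k n) (\<Sum>j<J. \<beta> n j *\<^sub>C d j)) f) \<longlonglongrightarrow>
        cinner ((B ^^ k n) (op_powr A (s n) x - x)) f" for n
      using series[of n] unfolding sums_def
      by (intro bounded_linear.tendsto[OF bounded_linear_cinner_left]
          bounded_linear.tendsto[OF bounded_linear_clinear[OF lin]])
    have partial: "(\<Sum>n<N. (cmod (cinner ((B ^^ k n) (\<Sum>j<J. \<beta> n j *\<^sub>C d j)) f))\<^sup>2) \<le> ?C * ?C * ?r" for J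
    proof -
      define z where "z n j = cinner ((B ^^ k n) (d j)) f" for n j
      have z: "(\<Sum>n<N. (cmod (z n j))\<^sup>2) \<le> ?r" for j
      proof -
        have "(\<Sum>n<N. (cmod (z n j))\<^sup>2) \<le> real D * (b * (norm (d j))\<^sup>2)"
          unfolding z_def
          by (rule sum_over_fibres_le[where h = "\<lambda>m. (cmod (cinner ((B ^^ m) (d j)) f))\<^sup>2"])
            (use D bessel in auto)
        also have "b * (norm (d j))\<^sup>2 \<le> b * (norm (A x - x))\<^sup>2"
        proof (cases "b \<ge> 0")
          case True
          then show ?thesis using norm_difference_power_le[OF A contraction, of j x]
            by (intro mult_left_mono power_mono) (auto simp: d_def)
        next
          case False
          then have "norm (d j) = 0" "norm (A x - x) = 0"
            using b0[of "d j"] b0[of "A x - x"] by (simp_all add: zero_le_mult_iff)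
          then show ?thesis by simp
        qed
        finally show ?thesis by (simp add: mult_left_mono)
      qed
      have "(\<Sum>n<N. (cmod (cinner ((B ^^ k n) (\<Sum>j<J. \<beta> n j *\<^sub>C d j)) f))\<^sup>2)
          = (\<Sum>n<N. (cmod (\<Sum>j<J. \<beta> n j * z n j))\<^sup>2)"
        by (simp add: clinear_sum[OF lin] clinear_scaleC[OF lin] cinner_sum_left cinner_scaleC_left z_def)
      also have "\<dots> \<le> (\<Sum>n<N. (\<Sum>j<J. c (Suc j)) * (\<Sum>j<J. c (Suc j) * (cmod (z n j))\<^sup>2))"
        using s c by (intro sum_mono norm_sum_scale_square_le) (auto simp: \<beta>_def)
      also have "\<dots> = (\<Sum>j<J. c (Suc j)) * (\<Sum>j<J. c (Suc j) * (\<Sum>n<N. (cmod (z n j))\<^sup>2))"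
        by (subst sum_distrib_left[symmetric], subst sum.swap) (simp add: sum_distrib_left)
      also have "\<dots> \<le> (\<Sum>j<J. c (Suc j)) * (\<Sum>j<J. c (Suc j) * ?r)"
        using c z by (intro mult_left_mono sum_mono sum_nonneg) auto
      also have "\<dots> = (\<Sum>j<J. c (Suc j)) * (\<Sum>j<J. c (Suc j)) * ?r"
        by (simp only: sum_distrib_right[symmetric] mult.assoc)
      also have "\<dots> \<le> ?C * ?C * ?r"
        using C C0 r0 c by (intro mult_right_mono mult_mono sum_nonneg) auto
      finally show ?thesis .
    qed
    show ?thesis
      by (rule LIMSEQ_le_const2[OF tendsto_sum[OF tendsto_power[OF tendsto_norm[OF lim]]]])
        (use partial in blast)
  qed
  then show ?thesis using C0 by (intro exI[of _ "?C * ?C"]) auto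
qed

lemma cmod_add_square_le: "(cmod (a + b))\<^sup>2 \<le> 2 * (cmod a)\<^sup>2 + 2 * (cmod b)\<^sup>2"
proof -
  have "(cmod (a + b))\<^sup>2 \<le> (cmod a + cmod b)\<^sup>2"
    by (intro power_mono norm_triangle_ineq norm_ge_zero)
  also have "\<dots> \<le> 2 * (cmod a)\<^sup>2 + 2 * (cmod b)\<^sup>2"
    using sum_squares_bound[of "cmod a" "cmod b"] by (simp add: power2_sum)
  finally show ?thesis .
qed

text \<open>A sampling point \<open>v (n + n\<^sub>0)\<close> of the second orbit is \<open>u k + s\<close> with \<open>1 \<le> s \<le> 1 + u\<close>,
  and a given \<open>k\<close> occurs for a bounded number of \<open>n\<close>. Writing \<open>A\<^sup>s = 1 + (A\<^sup>s - 1)\<close> bounds the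
  energy of the second orbit by that of the first one, up to an error controlled by \<open>A x - x\<close>.
  The shift by \<open>n\<^sub>0\<close> is what keeps \<open>s\<close> away from \<open>0\<close>.\<close>

lemma orbit_energy_comparison:
  fixes A :: "'a::chilbert_space \<Rightarrow> 'a"
  assumes A: "positive_op A" and contraction: "\<And>x. norm (A x) \<le> 1 * norm x"
    and uv: "u > 0" "v > 0" and n0: "v * real n0 \<ge> 1" and I: "finite I"
    and summable: "\<And>y. summable (orbit_energy (op_powr A u) f I y)"
    and upper: "\<And>y. suminf (orbit_energy (op_powr A u) f I y) \<le> b * (norm y)\<^sup>2"
  shows "\<exists>C\<ge>0. \<exists>C'\<ge>0. \<forall>x N. (\<Sum>n<N. orbit_energy (op_powr A v) f I x (n + n0))
    \<le> C * (norm (A x - x))\<^sup>2 + C' * suminf (orbit_energy (op_powr A u) f I x)"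
proof -
  have W: "1 \<le> 1 + u" using uv by simp
  obtain C where C: "C \<ge> 0" "\<And>B f b D (k :: nat \<Rightarrow> nat) s x N. bounded_clinear B \<Longrightarrow>
    (\<forall>y N. (\<Sum>m<N. (cmod (cinner ((B ^^ m) y) f))\<^sup>2) \<le> b * (norm y)\<^sup>2) \<Longrightarrow>
    (\<forall>m. card {n. n < N \<and> k n = m} \<le> D) \<Longrightarrow> (\<forall>n. 1 \<le> s n \<and> s n \<le> 1 + u) \<Longrightarrow>
    (\<Sum>n<N. (cmod (cinner ((B ^^ k n) (op_powr A (s n) x - x)) f))\<^sup>2)
      \<le> C * (real D * (b * (norm (A x - x))\<^sup>2))"
    using perturbed_samples_energy[OF A contraction W] by blast
  let ?B = "op_powr A u"
  have lin: "bounded_clinear ?B"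
    by (rule function_of_clinear[OF function_of_powr[OF A contraction uv(1)]])
  have energy_le: "(\<Sum>m<N. (cmod (cinner ((?B ^^ m) y) (f i)))\<^sup>2) \<le> suminf (orbit_energy ?B f I y)"
    if i: "i \<in> I" for N y i
  proof -
    have "(\<Sum>m<N. (cmod (cinner ((?B ^^ m) y) (f i)))\<^sup>2) \<le> (\<Sum>m<N. orbit_energy ?B f I y m)"
      unfolding orbit_energy_def
      using i I by (intro sum_mono member_le_sum[where f = "\<lambda>i. (cmod (cinner _ (f i)))\<^sup>2"]) auto
    also have "\<dots> \<le> suminf (orbit_energy ?B f I y)"
      by (intro sum_le_suminf summable) (auto simp: orbit_energy_nonneg)
    finally show ?thesis .
  qed
  have bessel: "(\<Sum>m<N. (cmod (cinner ((?B ^^ m) y) (f i)))\<^sup>2) \<le> b * (norm y)\<^sup>2" if "i \<in> I" for N y i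
    using energy_le[OF that] upper order_trans by blast
  define k where "k n = nat \<lfloor>(v * real (n + n0) - 1) / u\<rfloor>" for n
  define s where "s n = v * real (n + n0) - u * real (k n)" for n
  have k: "real (k n) \<le> (v * real (n + n0) - 1) / u" "(v * real (n + n0) - 1) / u < real (k n) + 1" for n
  proof -
    have "v * real n0 \<le> v * real (n + n0)" using uv by (intro mult_left_mono) auto
    then have "1 \<le> v * real (n + n0)" using n0 by linarith
    then have "0 \<le> (v * real (n + n0) - 1) / u" using uv by (intro divide_nonneg_pos) linarith+
    then have "real (k n) = of_int \<lfloor>(v * real (n + n0) - 1) / u\<rfloor>" by (simp add: k_def)
    then show "real (k n) \<le> (v * real (n + n0) - 1) / u" "(v * real (n + n0) - 1) / u < real (k n) + 1"
      by linarith+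
  qed
  have s: "1 \<le> s n" "s n \<le> 1 + u" for n
    using k[of n] uv by (simp_all add: s_def field_simps)
  define D where "D = nat \<lceil>u / v\<rceil>"
  have D: "card {n. n < N \<and> k n = m} \<le> D" for N m
  proof (rule card_le_of_diameter)
    fix p q assume "p \<in> {n. n < N \<and> k n = m}" "q \<in> {n. n < N \<and> k n = m}"
    then have "(v * real (q + n0) - 1) / u < (v * real (p + n0) - 1) / u + 1"
      using k(2)[of q] k(1)[of p] by simp
    moreover have "(v * real (q + n0) - 1) / u - (v * real (p + n0) - 1) / u = v * (real q - real p) / u"
      by (simp add: algebra_simps flip: diff_divide_distrib)
    ultimately have "v * (real q - real p) / u < 1" by linarith
    then have "real q - real p < u / v" using uv by (simp add: pos_divide_less_eq pos_less_divide_eq mult.commute)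
    then show "real q - real p < real D" unfolding D_def by linarith
  qed simp
  have orbit: "(op_powr A v ^^ (n + n0)) x = (?B ^^ k n) (op_powr A (s n) x)" for n x
  proof -
    have "n0 \<noteq> 0" using n0 by (cases "n0 = 0") auto
    then obtain j where j: "n + n0 = Suc j" by (cases "n + n0") auto
    have "(op_powr A v ^^ (n + n0)) x = op_powr A (v * real (n + n0)) x"
      unfolding j using op_powr_funpow_op_powr[OF A contraction uv(2) uv(2), of j x]
      by (simp add: funpow_swap1 algebra_simps)
    also have "\<dots> = (?B ^^ k n) (op_powr A (s n) x)"
      using op_powr_funpow_op_powr[OF A contraction uv(1), of "s n" "k n" x] s(1)[of n]
      by (simp add: s_def)
    finally show ?thesis .
  qed
  have single: "(\<Sum>n<N. (cmod (cinner ((op_powr A v ^^ (n + n0)) x) (f i)))\<^sup>2)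
      \<le> 2 * (C * (real D * (b * (norm (A x - x))\<^sup>2))) + 2 * (real D * suminf (orbit_energy ?B f I x))"
    if i: "i \<in> I" for i N x
  proof -
    let ?y = "\<lambda>n. cinner ((?B ^^ k n) (op_powr A (s n) x - x)) (f i)"
    let ?z = "\<lambda>n. cinner ((?B ^^ k n) x) (f i)"
    have "cinner ((op_powr A v ^^ (n + n0)) x) (f i) = ?y n + ?z n" for n
      unfolding orbit by (simp add: clinear_diff[OF bounded_clinear_funpow[OF lin]] cinner_diff_left)
    then have "(\<Sum>n<N. (cmod (cinner ((op_powr A v ^^ (n + n0)) x) (f i)))\<^sup>2)
        \<le> (\<Sum>n<N. 2 * (cmod (?y n))\<^sup>2 + 2 * (cmod (?z n))\<^sup>2)"
      by (simp add: sum_mono cmod_add_square_le)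
    also have "\<dots> = 2 * (\<Sum>n<N. (cmod (?y n))\<^sup>2) + 2 * (\<Sum>n<N. (cmod (?z n))\<^sup>2)"
      by (simp add: sum.distrib sum_distrib_left)
    also have "\<dots> \<le> 2 * (C * (real D * (b * (norm (A x - x))\<^sup>2)))
        + 2 * (real D * suminf (orbit_energy ?B f I x))"
    proof (intro add_mono mult_left_mono)
      show "(\<Sum>n<N. (cmod (?y n))\<^sup>2) \<le> C * (real D * (b * (norm (A x - x))\<^sup>2))"
        by (rule C(2)[OF lin]) (use bessel[OF i] D s in auto)
      show "(\<Sum>n<N. (cmod (?z n))\<^sup>2) \<le> real D * suminf (orbit_energy ?B f I x)"
        by (rule sum_over_fibres_le[where h = "\<lambda>m. (cmod (cinner ((?B ^^ m) x) (f i)))\<^sup>2"])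
          (use energy_le[OF i] D in auto)
    qed simp_all
    finally show ?thesis .
  qed
  let ?c = "real (card I)"
  have "(\<Sum>n<N. orbit_energy (op_powr A v) f I x (n + n0))
      \<le> \<bar>?c * 2 * C * real D * b\<bar> * (norm (A x - x))\<^sup>2
        + (?c * 2 * real D) * suminf (orbit_energy ?B f I x)" for N x
  proof -
    have "(\<Sum>n<N. orbit_energy (op_powr A v) f I x (n + n0))
        = (\<Sum>i\<in>I. \<Sum>n<N. (cmod (cinner ((op_powr A v ^^ (n + n0)) x) (f i)))\<^sup>2)"
      unfolding orbit_energy_def by (rule sum.swap)
    also have "\<dots> \<le> ?c * (2 * (C * (real D * (b * (norm (A x - x))\<^sup>2)))
        + 2 * (real D * suminf (orbit_energy ?B f I x)))"
      by (rule sum_bounded_above[OF single])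
    also have "\<dots> = (?c * 2 * C * real D * b) * (norm (A x - x))\<^sup>2
        + (?c * 2 * real D) * suminf (orbit_energy ?B f I x)"
      by (simp add: algebra_simps)
    also have "\<dots> \<le> \<bar>?c * 2 * C * real D * b\<bar> * (norm (A x - x))\<^sup>2
        + (?c * 2 * real D) * suminf (orbit_energy ?B f I x)"
      by (intro add_right_mono mult_right_mono abs_ge_self) simp
    finally show ?thesis .
  qed
  then show ?thesis
    by (intro exI[of _ "\<bar>?c * 2 * C * real D * b\<bar>"] conjI exI[of _ "?c * 2 * real D"]) simp_all
qed

section \<open>Lower bounds on subspaces of finite codimension\<close>

text \<open>In this lemma \<open>Q\<close> stands for the frame sum. A sequence of unit vectors along which \<open>Q\<close> tends
  to \<open>0\<close> differs by multiples of a single vector from vectors of a subspace on which \<open>Q\<close> controls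
  the norm. A convergent subsequence of the multiples gives a convergent subsequence of the vectors,
  and \<open>Q\<close> vanishes at its limit.\<close>

lemma lower_bound_finite_codimension:
  fixes Q :: "'a::chilbert_space \<Rightarrow> real"
  assumes V: "finite V"
    and Q0: "\<And>x. 0 \<le> Q x" and Qdiff: "\<And>x y. Q (x - y) \<le> 2 * Q x + 2 * Q y"
    and Qscale: "\<And>c x. Q (c *\<^sub>C x) = (cmod c)\<^sup>2 * Q x"
    and Qle: "\<And>x. Q x \<le> b * (norm x)\<^sup>2" and inj: "\<And>x. Q x = 0 \<Longrightarrow> x = 0"
    and lower: "\<exists>c>0. \<forall>x. (\<forall>v\<in>V. cinner x v = 0) \<longrightarrow> c * (norm x)\<^sup>2 \<le> Q x"
  shows "\<exists>c>0. \<forall>x. c * (norm x)\<^sup>2 \<le> Q x"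
  using V lower
proof (induction V rule: finite_induct)
  case empty
  then show ?case by simp
next
  case (insert v V)
  define W where "W = {x. \<forall>w\<in>V. cinner x w = 0}"
  have Wdiff: "x - y \<in> W" if "x \<in> W" "y \<in> W" for x y
    using that by (simp add: W_def cinner_diff_left)
  have Wscale: "a *\<^sub>C x \<in> W" if "x \<in> W" for a x
    using that by (simp add: W_def cinner_scaleC_left)
  obtain c where c: "c > 0" "\<And>x. x \<in> W \<Longrightarrow> cinner x v = 0 \<Longrightarrow> c * (norm x)\<^sup>2 \<le> Q x"
    using insert.prems by (auto simp: W_def)
  have "\<exists>c>0. \<forall>x\<in>W. c * (norm x)\<^sup>2 \<le> Q x"
  proof (cases "\<forall>x\<in>W. cinner x v = 0")
    case True
    then show ?thesis using c by blast
  next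
    case False
    then obtain w1 where w1: "w1 \<in> W" "cinner w1 v \<noteq> 0" by blast
    define w where "w = (1 / cinner w1 v) *\<^sub>C w1"
    have w: "w \<in> W" "cinner w v = 1" using w1 by (simp_all add: w_def Wscale cinner_scaleC_left)
    show ?thesis
    proof (rule ccontr)
      assume none: "\<not> ?thesis"
      have "\<exists>x\<in>W. norm x = 1 \<and> Q x < 1 / real (Suc n)" for n
      proof -
        have "0 < 1 / real (Suc n)" by simp
        then obtain y where y: "y \<in> W" "Q y < 1 / real (Suc n) * (norm y)\<^sup>2"
          using none by (meson not_le)
        have ny: "norm y > 0"
        proof (rule ccontr)
          assume "\<not> norm y > 0"
          then have "norm y = 0" by simp
          then show False using y(2) Q0[of y] by simp
        qed
        let ?x = "complex_of_real (1 / norm y) *\<^sub>C y"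
        have "norm ?x = 1" using ny by (simp add: norm_scaleC norm_divide)
        moreover have "Q ?x = Q y / (norm y)\<^sup>2"
          using ny by (simp add: Qscale norm_divide power_divide)
        then have "Q ?x < 1 / real (Suc n)" using y(2) ny by (simp add: pos_divide_less_eq)
        ultimately show ?thesis using Wscale[OF y(1)] by blast
      qed
      then obtain X where X: "\<And>n. X n \<in> W" "\<And>n. norm (X n) = 1" "\<And>n. Q (X n) < 1 / real (Suc n)"
        by metis
      define \<alpha> where "\<alpha> n = cinner (X n) v" for n
      have "bounded (range \<alpha>)"
        using cauchy_schwarz[of "X _" v] X(2) by (auto simp: bounded_iff \<alpha>_def intro!: exI[of _ "norm v"])
      then obtain r l where r: "strict_mono r" and l: "(\<alpha> \<circ> r) \<longlonglongrightarrow> l"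
        using bounded_imp_convergent_subsequence by blast
      have QX: "(\<lambda>n. Q (X (r n))) \<longlonglongrightarrow> 0"
      proof (rule tendsto_sandwich[OF _ _ tendsto_const LIMSEQ_inverse_real_of_nat])
        have "Q (X (r n)) \<le> inverse (real (Suc n))" for n
        proof -
          have "Q (X (r n)) \<le> 1 / real (Suc (r n))" using X(3) less_imp_le by blast
          also have "\<dots> \<le> 1 / real (Suc n)"
            using seq_suble[OF r, of n] by (intro divide_left_mono) auto
          finally show ?thesis by (simp add: inverse_eq_divide)
        qed
        then show "\<forall>\<^sub>F n in sequentially. Q (X (r n)) \<le> inverse (real (Suc n))" by simp
      qed (simp add: Q0)
      define Y where "Y n = X (r n)" for n
      define Z where "Z n = Y n - (\<alpha> (r n)) *\<^sub>C w" for n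
      have ZW: "Z m - Z n \<in> W" "cinner (Z m - Z n) v = 0" for m n
        using X(1) w by (simp_all add: Z_def Y_def Wdiff Wscale cinner_diff_left cinner_scaleC_left \<alpha>_def)
      have "Cauchy Y"
      proof (rule metric_CauchyI)
        fix e :: real assume e: "e > 0"
        have ca: "Cauchy (\<alpha> \<circ> r)" using l convergent_Cauchy convergent_def by blast
        \<comment> \<open>For \<open>|a| < \<delta>\<close> both \<open>\<parallel>a w\<parallel> \<le> e/2\<close> and \<open>|a|\<^sup>2 Q w \<le> c (e/2)\<^sup>2 / 4\<close>.\<close>
        define \<delta> where "\<delta> = min (e / (2 * (norm w + 1))) (sqrt (c * (e / 2)\<^sup>2 / (4 * (Q w + 1))))"
        have nw: "norm w + 1 > 0" by (simp add: add_nonneg_pos)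
        have qw: "Q w + 1 > 0" using Q0[of w] by simp
        have \<delta>: "\<delta> > 0" using e c nw qw by (simp add: \<delta>_def)
        obtain N1 where N1: "\<And>m n. m \<ge> N1 \<Longrightarrow> n \<ge> N1 \<Longrightarrow> cmod (\<alpha> (r m) - \<alpha> (r n)) < \<delta>"
          using metric_CauchyD[OF ca \<delta>] by (auto simp: dist_norm)
        have "0 < c * (e / 2)\<^sup>2 / 16" using c e by simp
        from order_tendstoD(2)[OF QX this] obtain N2 where
          N2: "\<And>n. n \<ge> N2 \<Longrightarrow> Q (Y n) < c * (e / 2)\<^sup>2 / 16"
          by (auto simp: eventually_sequentially Y_def)
        have "dist (Y m) (Y n) < e" if mn: "m \<ge> max N1 N2" "n \<ge> max N1 N2" for m n
        proof -
          define a where "a = \<alpha> (r m) - \<alpha> (r n)"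
          have a: "cmod a < \<delta>" using N1 mn by (simp add: a_def)
          have Zd: "Z m - Z n = (Y m - Y n) - a *\<^sub>C w"
            by (simp add: Z_def a_def complex_vector.scale_left_diff_distrib)
          have aw: "(cmod a)\<^sup>2 * Q w \<le> c * (e / 2)\<^sup>2 / 4"
          proof -
            have "(cmod a)\<^sup>2 \<le> \<delta>\<^sup>2" using a by (intro power_mono) auto
            also have "\<dots> \<le> (sqrt (c * (e / 2)\<^sup>2 / (4 * (Q w + 1))))\<^sup>2"
              using \<delta> by (intro power_mono) (auto simp: \<delta>_def)
            also have "\<dots> = c * (e / 2)\<^sup>2 / (4 * (Q w + 1))" using c qw by simp
            finally have "(cmod a)\<^sup>2 * Q w \<le> c * (e / 2)\<^sup>2 / (4 * (Q w + 1)) * Q w"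
              using Q0 by (rule mult_right_mono)
            also have "\<dots> \<le> c * (e / 2)\<^sup>2 / (4 * (Q w + 1)) * (Q w + 1)"
              using c qw by (intro mult_left_mono) auto
            also have "\<dots> = c * (e / 2)\<^sup>2 / 4" using qw by (simp add: field_simps)
            finally show ?thesis .
          qed
          have "c * (norm (Z m - Z n))\<^sup>2 \<le> Q (Z m - Z n)" by (rule c(2)[OF ZW])
          also have "\<dots> \<le> 2 * Q (Y m - Y n) + 2 * Q (a *\<^sub>C w)" unfolding Zd by (rule Qdiff)
          also have "\<dots> \<le> 2 * (2 * Q (Y m) + 2 * Q (Y n)) + 2 * ((cmod a)\<^sup>2 * Q w)"
            using Qdiff[of "Y m" "Y n"] by (simp add: Qscale)
          also have "\<dots> < c * (e / 2)\<^sup>2"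
          proof -
            have "2 * (2 * r + 2 * s) + 2 * u < t" if "r < t / 16" "s < t / 16" "u \<le> t / 4" for r s t u :: real
              using that by simp
            then show ?thesis using N2[of m] N2[of n] mn aw by simp
          qed
          finally have "(norm (Z m - Z n))\<^sup>2 < (e / 2)\<^sup>2" using c by simp
          then have zz: "norm (Z m - Z n) < e / 2" by (rule power2_less_imp_less) (use e in simp)
          have "norm (a *\<^sub>C w) \<le> e / 2"
          proof -
            have "norm (a *\<^sub>C w) \<le> \<delta> * (norm w + 1)"
              unfolding norm_scaleC using a \<delta> by (intro mult_mono) auto
            also have "\<dots> \<le> e / (2 * (norm w + 1)) * (norm w + 1)"
              using nw by (intro mult_right_mono) (auto simp: \<delta>_def)
            also have "\<dots> = e / 2" using nw by (simp add: field_simps)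
            finally show ?thesis .
          qed
          then show ?thesis
            using zz norm_triangle_ineq[of "Z m - Z n" "a *\<^sub>C w"] by (simp add: Zd dist_norm)
        qed
        then show "\<exists>N. \<forall>m\<ge>N. \<forall>n\<ge>N. dist (Y m) (Y n) < e" by blast
      qed
      then obtain x where x: "Y \<longlonglongrightarrow> x" using Cauchy_convergent_iff convergent_def by blast
      have "(\<lambda>n. 2 * Q (Y n) + 2 * (b * (norm (Y n - x))\<^sup>2)) \<longlonglongrightarrow> 2 * 0 + 2 * (b * (norm (x - x))\<^sup>2)"
        using QX by (intro tendsto_intros x) (simp add: Y_def)
      moreover have "Q x \<le> 2 * Q (Y n) + 2 * (b * (norm (Y n - x))\<^sup>2)" for n
        using Qdiff[of "Y n" "Y n - x"] Qle[of "Y n - x"] by simp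
      ultimately have "Q x \<le> 0" using LIMSEQ_le_const by fastforce
      then have "x = 0" using inj Q0[of x] by simp
      moreover have "(\<lambda>n. 1) \<longlonglongrightarrow> norm x" using tendsto_norm[OF x] X(2) by (simp add: Y_def)
      then have "1 = norm x" by (rule LIMSEQ_unique[OF tendsto_const])
      ultimately show False by simp
    qed
  qed
  then show ?case by (intro insert.IH) (auto simp: W_def)
qed

text \<open>A vector \<open>y = A x - x\<close> whose first \<open>n\<close> samples vanish has the same energy as \<open>A\<^sup>n y\<close>, so the
  frame inequalities give \<open>\<parallel>y\<parallel> \<le> const \<cdot> \<parallel>A\<^sup>n (A x - x)\<parallel> \<le> const \<cdot> \<parallel>x\<parallel> / n\<close>. In other words,
  \<open>A - 1\<close> is compact.\<close>

lemma frame_generator_near_identity: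
  fixes A :: "'a::chilbert_space \<Rightarrow> 'a"
  assumes A: "positive_op A" and contraction: "\<And>x. norm (A x) \<le> 1 * norm x"
    and I: "finite I" and a: "0 < a"
    and summable: "\<And>x. summable (orbit_energy A f I x)"
    and lower: "\<And>x. a * (norm x)\<^sup>2 \<le> suminf (orbit_energy A f I x)"
    and upper: "\<And>x. suminf (orbit_energy A f I x) \<le> b * (norm x)\<^sup>2"
    and e: "e > 0"
  obtains V where "finite V" "\<And>x. (\<forall>v\<in>V. cinner x v = 0) \<Longrightarrow> (norm (A x - x))\<^sup>2 \<le> e * (norm x)\<^sup>2"
proof -
  have sa: "selfadjoint_op A" using A by (simp add: positive_op_def)
  have lin: "bounded_clinear A" by (rule positive_op_clinear[OF A])
  define b' where "b' = max b 0"
  obtain n where n: "b' / (a * e) < real n" using reals_Archimedean2 by blast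
  let ?V = "(\<lambda>(j, i). (A ^^ j) (A (f i) - f i)) ` ({..<n} \<times> I)"
  show ?thesis
  proof (rule that)
    show "finite ?V" using I by simp
    fix x assume x: "\<forall>v\<in>?V. cinner x v = 0"
    let ?y = "A x - x"
    have "cinner ((A ^^ j) ?y) (f i) = 0" if "j < n" "i \<in> I" for i j
    proof -
      have "cinner ((A ^^ j) ?y) (f i) = cinner ?y ((A ^^ j) (f i))"
        by (rule selfadjoint_op_funpow[OF sa])
      also have "\<dots> = cinner x (A ((A ^^ j) (f i)) - (A ^^ j) (f i))"
        using sa by (simp add: selfadjoint_op_def cinner_diff_left cinner_diff_right)
      also have "A ((A ^^ j) (f i)) - (A ^^ j) (f i) = (A ^^ j) (A (f i) - f i)"
        by (simp add: clinear_diff[OF bounded_clinear_funpow[OF lin]] funpow_swap1)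
      also have "cinner x \<dots> = 0" using x that by force
      finally show ?thesis .
    qed
    then have "orbit_energy A f I ?y j = 0" if "j < n" for j
      using that by (simp add: orbit_energy_def)
    then have "suminf (orbit_energy A f I ?y) = (\<Sum>j. orbit_energy A f I ?y (j + n))"
      using suminf_split_initial_segment[OF summable, of ?y n] by simp
    also have "(\<lambda>j. orbit_energy A f I ?y (j + n)) = orbit_energy A f I ((A ^^ n) ?y)"
      by (simp add: fun_eq_iff orbit_energy_shift)
    finally have eq: "suminf (orbit_energy A f I ?y) = suminf (orbit_energy A f I ((A ^^ n) ?y))" .
    have "a * (norm ?y)\<^sup>2 \<le> b * (norm ((A ^^ n) ?y))\<^sup>2"
      using lower[of ?y] upper[of "(A ^^ n) ?y"] eq by linarith
    also have "\<dots> \<le> b' * (norm ((A ^^ n) ?y))\<^sup>2" by (rule mult_right_mono) (auto simp: b'_def)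
    also have "\<dots> \<le> b' * (norm x / (real n + 1))\<^sup>2"
      using norm_power_difference_le[OF A contraction, of n x]
      by (intro mult_left_mono power_mono) (auto simp: b'_def)
    also have "\<dots> = b' / (real n + 1)\<^sup>2 * (norm x)\<^sup>2" by (simp add: power_divide)
    also have "\<dots> \<le> (a * e) * (norm x)\<^sup>2"
    proof (rule mult_right_mono)
      have "b' \<le> real n * (a * e)" using n a e by (simp add: pos_divide_less_eq)
      also have "\<dots> \<le> (real n + 1)\<^sup>2 * (a * e)"
        using a e by (intro mult_right_mono) (auto simp: power2_eq_square algebra_simps)
      finally show "b' / (real n + 1)\<^sup>2 \<le> a * e" by (simp add: pos_divide_le_eq mult.commute)
    qed simp
    finally show "(norm ?y)\<^sup>2 \<le> e * (norm x)\<^sup>2" using a by (simp add: mult.assoc)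
  qed
qed

text \<open>The vectors whose samples all vanish form a closed subspace that is invariant under \<open>B\<close>, hence
  under polynomials of \<open>B\<close> and under their limit \<open>A\<close>.\<close>

lemma samples_vanish_of_polys_approximate:
  fixes A B :: "'a::complex_inner \<Rightarrow> 'a"
  assumes B: "selfadjoint_op B"
    and approx: "\<And>e. e > 0 \<Longrightarrow> \<exists>q. \<forall>y. norm (op_poly q B y - A y) \<le> e * norm y"
    and zero: "\<And>n. cinner ((B ^^ n) x) g = 0"
  shows "cinner ((A ^^ n) x) g = 0"
proof -
  have lin: "bounded_clinear B" using B by (simp add: selfadjoint_op_def)
  have step: "cinner ((B ^^ m) (A y)) g = 0" if y: "\<And>n. cinner ((B ^^ n) y) g = 0" for y m
  proof -
    let ?g = "(B ^^ m) g"
    have "cmod (cinner (A y) ?g) \<le> 0"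
    proof (rule le_of_le_epsilon_mult)
      fix e :: real assume "e > 0"
      from approx[OF this] obtain q where q: "\<And>y. norm (op_poly q B y - A y) \<le> e * norm y" by blast
      have "cinner ((B ^^ k) y) ?g = 0" for k
        using y[of "m + k"] by (simp add: funpow_add selfadjoint_op_funpow[OF B])
      then have "cinner (op_poly q B y) ?g = 0"
        by (simp add: op_poly_def cinner_sum_left cinner_scaleC_left)
      then have "cmod (cinner (A y) ?g) = cmod (cinner (op_poly q B y - A y) ?g)"
        by (simp add: cinner_diff_left)
      also have "\<dots> \<le> e * norm y * norm ?g"
        by (rule order_trans[OF cauchy_schwarz mult_right_mono[OF q norm_ge_zero]])
      finally show "cmod (cinner (A y) ?g) \<le> 0 + e * (norm y * norm ?g)" by (simp add: mult.assoc)
    qed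
    then show ?thesis by (simp add: selfadjoint_op_funpow[OF B])
  qed
  have "cinner ((B ^^ m) ((A ^^ n) x)) g = 0" for m
    by (induction n arbitrary: m) (use zero step in auto)
  from this[of 0] show ?thesis by simp
qed

section \<open>Frames generated by powers\<close>

lemma orbit_energy_diff_le:
  assumes "bounded_clinear T"
  shows "orbit_energy T f I (x - y) n \<le> 2 * orbit_energy T f I x n + 2 * orbit_energy T f I y n"
proof -
  have "(cmod (cinner ((T ^^ n) (x - y)) (f i)))\<^sup>2
      \<le> 2 * (cmod (cinner ((T ^^ n) x) (f i)))\<^sup>2 + 2 * (cmod (cinner ((T ^^ n) y) (f i)))\<^sup>2" for i
    using cmod_add_square_le[of "cinner ((T ^^ n) x) (f i)" "- cinner ((T ^^ n) y) (f i)"]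
    by (simp add: clinear_diff[OF bounded_clinear_funpow[OF assms]] cinner_diff_left)
  then have "orbit_energy T f I (x - y) n
      \<le> (\<Sum>i\<in>I. 2 * (cmod (cinner ((T ^^ n) x) (f i)))\<^sup>2 + 2 * (cmod (cinner ((T ^^ n) y) (f i)))\<^sup>2)"
    unfolding orbit_energy_def by (rule sum_mono)
  then show ?thesis by (simp add: orbit_energy_def sum.distrib sum_distrib_left)
qed

lemma orbit_energy_scaleC:
  assumes "bounded_clinear T"
  shows "orbit_energy T f I (c *\<^sub>C x) n = (cmod c)\<^sup>2 * orbit_energy T f I x n"
  by (simp add: orbit_energy_def clinear_scaleC[OF bounded_clinear_funpow[OF assms]]
      cinner_scaleC_left norm_mult power_mult_distrib sum_distrib_left)

lemma op_powr_orbit_frame: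
  fixes A :: "'a::chilbert_space \<Rightarrow> 'a"
  assumes A: "positive_op A" and I: "finite I" and p: "p > 0"
    and frame: "is_frame ((UNIV::nat set) \<times> I) (\<lambda>(n, i). (A ^^ n) (f i))"
  shows "is_frame ((UNIV::nat set) \<times> I) (\<lambda>(n, i). (op_powr A p ^^ n) (f i))"
proof -
  have sa: "selfadjoint_op A" using A by (simp add: positive_op_def)
  obtain a b where a: "0 < a" and sumA: "\<And>x. summable (orbit_energy A f I x)"
    and lowA: "\<And>x. a * (norm x)\<^sup>2 \<le> suminf (orbit_energy A f I x)"
    and upA: "\<And>x. suminf (orbit_energy A f I x) \<le> b * (norm x)\<^sup>2"
    using frame unfolding is_frame_orbit_iff[OF sa I] by blast
  have contraction: "norm (A x) \<le> 1 * norm x" for x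
    using orbit_frame_contraction[OF sa a sumA lowA upA] by simp
  define B where "B = op_powr A p"
  have A1: "op_powr A 1 = A" by (rule op_powr_one[OF A contraction])
  have saB: "selfadjoint_op B"
    using positive_op_powr[OF A contraction p] by (simp add: positive_op_def B_def)
  have linB: "bounded_clinear B" using saB by (simp add: selfadjoint_op_def)
  let ?E = "orbit_energy B f I"

  \<comment> \<open>Bessel bound: compare the orbit of \<open>A\<^sup>p\<close> with that of \<open>A\<close>, apart from the first \<open>n\<^sub>0\<close> terms.\<close>
  obtain n0 where "1 / p < real n0" using reals_Archimedean2 by blast
  then have n0: "1 \<le> p * real n0" using p by (simp add: pos_divide_less_eq mult.commute)
  obtain C C' where C: "C \<ge> 0" "C' \<ge> 0" and
    shifted: "\<And>x N. (\<Sum>n<N. ?E x (n + n0)) \<le> C * (norm (A x - x))\<^sup>2 + C' * suminf (orbit_energy A f I x)"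
    using orbit_energy_comparison[OF A contraction _ p n0 I, of 1 f b] sumA upA
    unfolding A1 B_def by auto
  have powB: "norm ((B ^^ n) x) \<le> norm x" for n x
  proof (induction n)
    case (Suc n)
    have "norm (B y) \<le> norm y" for y
      using op_powr_norm_le[OF A contraction p, of y] by (simp add: B_def)
    from order_trans[OF this Suc] show ?case by simp
  qed simp
  define F where "F = (\<Sum>i\<in>I. (norm (f i))\<^sup>2)"
  have single: "?E x n \<le> F * (norm x)\<^sup>2" for x n
  proof -
    have "(cmod (cinner ((B ^^ n) x) (f i)))\<^sup>2 \<le> (norm (f i))\<^sup>2 * (norm x)\<^sup>2" for i
    proof -
      have "cmod (cinner ((B ^^ n) x) (f i)) \<le> norm x * norm (f i)"
        by (rule order_trans[OF cauchy_schwarz mult_right_mono[OF powB norm_ge_zero]])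
      from power_mono[OF this norm_ge_zero, of 2] show ?thesis
        by (simp add: power_mult_distrib mult.commute)
    qed
    then show ?thesis by (simp add: orbit_energy_def F_def sum_distrib_right sum_mono)
  qed
  define b' where "b' = real n0 * F + 4 * C + C' * b"
  have partial: "(\<Sum>n<N. ?E x n) \<le> b' * (norm x)\<^sup>2" for x N
  proof -
    have "(\<Sum>n<N. ?E x n) \<le> (\<Sum>n<n0 + N. ?E x n)"
      by (rule sum_mono2) (auto simp: orbit_energy_nonneg)
    also have "\<dots> = (\<Sum>n<n0. ?E x n) + (\<Sum>n<N. ?E x (n + n0))"
      by (induction N) (simp_all add: add_ac)
    also have "\<dots> \<le> real n0 * (F * (norm x)\<^sup>2) + (C * (4 * (norm x)\<^sup>2) + C' * (b * (norm x)\<^sup>2))"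
    proof (intro add_mono order_trans[OF shifted])
      show "(\<Sum>n<n0. ?E x n) \<le> real n0 * (F * (norm x)\<^sup>2)"
        using sum_bounded_above[of "{..<n0}" "?E x" "F * (norm x)\<^sup>2"] single by simp
      have "norm (A x - x) \<le> 2 * norm x"
        using norm_triangle_ineq4[of "A x" x] contraction[of x] by simp
      from power_mono[OF this norm_ge_zero, of 2]
      show "C * (norm (A x - x))\<^sup>2 \<le> C * (4 * (norm x)\<^sup>2)"
        using C by (intro mult_left_mono) (auto simp: power_mult_distrib)
      show "C' * suminf (orbit_energy A f I x) \<le> C' * (b * (norm x)\<^sup>2)"
        using C upA by (intro mult_left_mono) auto
    qed
    also have "\<dots> = b' * (norm x)\<^sup>2" by (simp add: b'_def algebra_simps)
    finally show ?thesis .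
  qed
  have sumB: "summable (?E x)" for x
    by (rule summableI_nonneg_bounded[OF _ partial]) (rule orbit_energy_nonneg)
  define Q where "Q x = suminf (?E x)" for x
  have upB: "Q x \<le> b' * (norm x)\<^sup>2" for x
    unfolding Q_def by (rule suminf_le_const[OF sumB partial])
  have Q0: "0 \<le> Q x" for x unfolding Q_def by (rule suminf_nonneg[OF sumB orbit_energy_nonneg])

  \<comment> \<open>The reverse comparison bounds the frame sum of \<open>A\<close> at \<open>A x\<close>.\<close>
  obtain D D' where D: "D \<ge> 0" "D' \<ge> 0" and
    backward: "\<And>x N. (\<Sum>n<N. orbit_energy A f I x (n + 1)) \<le> D * (norm (A x - x))\<^sup>2 + D' * Q x"
    using orbit_energy_comparison[OF A contraction p, of 1 1 I f b'] I sumB upB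
    unfolding A1 B_def[symmetric] Q_def by auto
  have lowB: "a * (norm (A x))\<^sup>2 \<le> D * (norm (A x - x))\<^sup>2 + D' * Q x" for x
  proof -
    have eq: "orbit_energy A f I (A x) = (\<lambda>n. orbit_energy A f I x (n + 1))"
      using orbit_energy_shift[of A f I 1 x] by (simp add: fun_eq_iff)
    have "suminf (orbit_energy A f I (A x)) \<le> D * (norm (A x - x))\<^sup>2 + D' * Q x"
      by (rule suminf_le_const[OF sumA]) (unfold eq, rule backward)
    then show ?thesis using lowA[of "A x"] by linarith
  qed

  \<comment> \<open>With \<open>\<parallel>A x - x\<parallel>\<^sup>2 \<le> e \<parallel>x\<parallel>\<^sup>2\<close> and \<open>e \<le> 1/4\<close> one has \<open>\<parallel>A x\<parallel>\<^sup>2 \<ge> \<parallel>x\<parallel>\<^sup>2 / 4\<close>; the second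
    bound on \<open>e\<close> makes the error term at most half of \<open>a \<parallel>x\<parallel>\<^sup>2 / 4\<close>.\<close>
  define e where "e = min (1 / 4) (a / (8 * (D + 1)))"
  have e: "e > 0" "e \<le> 1 / 4" "D * e \<le> a / 8"
  proof -
    show "e > 0" using a D by (simp add: e_def)
    show "e \<le> 1 / 4" unfolding e_def by (rule min.cobounded1)
    have "D * e \<le> (D + 1) * (a / (8 * (D + 1)))"
      using D a by (intro mult_mono) (auto simp: e_def)
    moreover have "(D + 1) * (a / (8 * (D + 1))) = a / 8" using D by (simp add: field_simps)
    ultimately show "D * e \<le> a / 8" by (simp only:)
  qed
  obtain V where V: "finite V"
    "\<And>x. (\<forall>v\<in>V. cinner x v = 0) \<Longrightarrow> (norm (A x - x))\<^sup>2 \<le> e * (norm x)\<^sup>2"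
    using frame_generator_near_identity[OF A contraction I a sumA lowA upA e(1)] by metis
  have "\<exists>c>0. \<forall>x. c * (norm x)\<^sup>2 \<le> Q x"
  proof (rule lower_bound_finite_codimension[OF V(1) Q0 _ _ upB])
    show "Q (x - y) \<le> 2 * Q x + 2 * Q y" for x y
    proof -
      have "Q (x - y) \<le> (\<Sum>n. 2 * ?E x n + 2 * ?E y n)"
        unfolding Q_def
        by (intro suminf_le orbit_energy_diff_le linB sumB summable_add summable_mult)
      also have "\<dots> = 2 * Q x + 2 * Q y"
        unfolding Q_def
        by (subst suminf_add[symmetric]) (simp_all add: sumB summable_mult suminf_mult)
      finally show ?thesis .
    qed
    show "Q (c *\<^sub>C x) = (cmod c)\<^sup>2 * Q x" for c x
    proof -
      have "?E (c *\<^sub>C x) = (\<lambda>n. (cmod c)\<^sup>2 * ?E x n)"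
        by (simp add: fun_eq_iff orbit_energy_scaleC[OF linB])
      then show ?thesis unfolding Q_def by (simp add: suminf_mult[OF sumB])
    qed
    show "x = 0" if "Q x = 0" for x
    proof -
      have "?E x n = 0" for n
        using that suminf_eq_zero_iff[OF sumB orbit_energy_nonneg] by (simp add: Q_def)
      then have B0: "cinner ((B ^^ n) x) (f i) = 0" if "i \<in> I" for i n
        using that I by (simp add: orbit_energy_def sum_nonneg_eq_0_iff)
      have approx: "\<exists>q. \<forall>y. norm (op_poly q B y - A y) \<le> e * norm y" if "e > 0" for e
        using polys_of_op_powr_approximate[OF A contraction p that] unfolding B_def by metis
      have "cinner ((A ^^ n) x) (f i) = 0" if "i \<in> I" for i n
        by (rule samples_vanish_of_polys_approximate[OF saB approx B0[OF that]])
      then have "orbit_energy A f I x = (\<lambda>n. 0)" by (simp add: orbit_energy_def fun_eq_iff)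
      then have "a * (norm x)\<^sup>2 \<le> 0" using lowA[of x] by simp
      then show "x = 0" using a by (simp add: mult_le_0_iff)
    qed
    show "\<exists>c>0. \<forall>x. (\<forall>v\<in>V. cinner x v = 0) \<longrightarrow> c * (norm x)\<^sup>2 \<le> Q x"
    proof (intro exI[of _ "a / (8 * (D' + 1))"] conjI allI impI)
      show "0 < a / (8 * (D' + 1))" using a D by simp
      fix x assume x: "\<forall>v\<in>V. cinner x v = 0"
      have d: "(norm (A x - x))\<^sup>2 \<le> e * (norm x)\<^sup>2" by (rule V(2)[OF x])
      have "(norm (A x - x))\<^sup>2 \<le> (norm x / 2)\<^sup>2"
        using d mult_right_mono[OF e(2), of "(norm x)\<^sup>2"] by (simp add: power_divide)
      then have "norm (A x - x) \<le> norm x / 2" by (rule power2_le_imp_le) simp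
      then have "norm x / 2 \<le> norm (A x)"
        using norm_triangle_sub[of x "A x"] by (simp add: norm_minus_commute)
      from power_mono[OF this, of 2] have "a * ((norm x)\<^sup>2 / 4) \<le> a * (norm (A x))\<^sup>2"
        using a by (intro mult_left_mono) (auto simp: power_divide)
      moreover have "D * (norm (A x - x))\<^sup>2 \<le> a / 8 * (norm x)\<^sup>2"
        using mult_left_mono[OF d D(1)] mult_right_mono[OF e(3), of "(norm x)\<^sup>2"]
        by (simp add: mult.assoc)
      ultimately have "a / 8 * (norm x)\<^sup>2 \<le> D' * Q x" using lowB[of x] by simp
      also have "\<dots> \<le> (D' + 1) * Q x" using Q0 by (intro mult_right_mono) auto
      finally show "a / (8 * (D' + 1)) * (norm x)\<^sup>2 \<le> Q x" using D by (simp add: field_simps)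
    qed
  qed
  then obtain c where "c > 0" "\<And>x. c * (norm x)\<^sup>2 \<le> Q x" by blast
  then show ?thesis
    using is_frame_orbit_iff[OF saB I, of f] sumB upB unfolding Q_def B_def by blast
qed

theorem theorem4p3:
  fixes A :: "'a::chilbert_space \<Rightarrow> 'a"
    and I :: "'i set"
    and f :: "'i \<Rightarrow> 'a"
  assumes "infinite_dimensional TYPE('a)"
    and "separable TYPE('a)"
    and "positive_op A"
    and "finite I"
  shows "\<forall>p::real. p > 0 \<longrightarrow>
    (is_frame ((UNIV::nat set) \<times> I) (\<lambda>(n, i). (A ^^ n) (f i)) \<longleftrightarrow>
     is_frame ((UNIV::nat set) \<times> I) (\<lambda>(n, i). (op_powr A p ^^ n) (f i)))"
proof (intro allI impI iffI)
  fix p :: real assume p: "p > 0"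
  show "is_frame ((UNIV::nat set) \<times> I) (\<lambda>(n, i). (op_powr A p ^^ n) (f i))"
    if "is_frame ((UNIV::nat set) \<times> I) (\<lambda>(n, i). (A ^^ n) (f i))"
    by (rule op_powr_orbit_frame[OF assms(3,4) p that])
  have K: "norm (A x) \<le> onorm A * norm x" for x
    by (rule onorm[OF bounded_linear_clinear[OF positive_op_clinear[OF assms(3)]]])
  have B: "positive_op (op_powr A p)" by (rule positive_op_powr[OF assms(3) K p])
  show "is_frame ((UNIV::nat set) \<times> I) (\<lambda>(n, i). (A ^^ n) (f i))"
    if "is_frame ((UNIV::nat set) \<times> I) (\<lambda>(n, i). (op_powr A p ^^ n) (f i))"
    using op_powr_orbit_frame[OF B assms(4) _ that, of "1 / p"] p
    by (simp add: op_powr_inverse[OF assms(3) p])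
qed

end
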